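(* Let $|q|=1$ and let $\mu\in\mathbb{R}$. The conjugate-bilinear form $(\cdot,\cdot)$ on $V$ defined recursively on the basis $\mathcal{B}$ (see context) is a Hermitian form on $V$, contravariant with respect to $\pi$ and $\omega$, i.e. $(x.u,v)=(u,\omega(x).v)$ for all $x\in\widetilde{\mathfrak{gl}_3(\mathbb{C}_q)}$ and $u,v\in V$.
   Context: **The Lie algebra.** $q\in\mathbb{C}$ with $|q|=1$. $\mathbb{C}_q=\mathbb{C}_q[s^{\pm1},t^{\pm1}]$ is the unital associative $\mathbb{C}$-algebra generated by $s^{\pm1},t^{\pm1}$ with $ss^{-1}=s^{-1}s=tt^{-1}=t^{-1}t=1$ and $ts=qst$. $\mathfrak{gl}_3(\mathbb{C}_q)$ is the Lie algebra of $3\times3$ matrices over $\mathbb{C}_q$, and $E_{ij}(a)$ has $(i,j)$ entry $a$ and $0$ elsewhere. $\widehat{\mathfrak{gl}_3(\mathbb{C}_q)}=\mathfrak{gl}_3(\mathbb{C}_q)\oplus\mathbb{C}c_s\oplus\mathbb{C}c_t$ with $c_s,c_t$ central and $$[E_{ij}(s^{m_1}t^{n_1}),E_{kl}(s^{m_2}t^{n_2})]=\delta_{jk}q^{n_1m_2}E_{il}(s^{m_1+m_2}t^{n_1+n_2})-\delta_{il}q^{n_2m_1}E_{kj}(s^{m_1+m_2}t^{n_1+n_2})+q^{n_1m_2}\delta_{jk}\delta_{il}\delta_{m_1+m_2,0}\delta_{n_1+n_2,0}(m_1c_s+n_1c_t).$$ $\widetilde{\mathfrak{gl}_3(\mathbb{C}_q)}=\widehat{\mathfrak{gl}_3(\mathbb{C}_q)}\oplus\mathbb{C}d_s\oplus\mathbb{C}d_t$,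 with $[d_s,E_{ij}(s^mt^n)]=mE_{ij}(s^mt^n)$, $[d_t,E_{ij}(s^mt^n)]=nE_{ij}(s^mt^n)$, $[d_s,d_t]=0$, $d_s,d_t$ commuting with $c_s,c_t$. **The module.** $\mathbb{K}_1=\{(3m+1,3n+1):m,n\in\mathbb{Z}\}$, $\mathbb{K}_{-1}=\{(3m-1,3n-1):m,n\in\mathbb{Z}\}$. For $A=(3m+1,3n+1)\in\mathbb{K}_1$ write $A_1=m$, $A_2=n$; for $B=(3m-1,3n-1)\in\mathbb{K}_{-1}$ write $B_1=m$, $B_2=n$. $V=\mathbb{C}[x_A,x_B:A\in\mathbb{K}_1,B\in\mathbb{K}_{-1}]$. Fix matrices $X_{(m,n)}=\begin{pmatrix}a_{(m,n)}&0\\c_{(m,n)}&d_{(m,n)}\end{pmatrix}\in SL_2(\mathbb{C})$ for $(m,n)\in\mathbb{K}_1\cup\mathbb{K}_{-1}$ and let $P_{(m,n)}=a_{(m,n)}\frac{\partial}{\partial x_{(m,n)}}$, $Q_{(m,n)}=c_{(m,n)}\frac{\partial}{\partial x_{(m,n)}}+d_{(m,n)}x_{(m,n)}$. In the sums $A,A'\in\mathbb{K}_1$, $B,B'\in\mathbb{K}_{-1}$, and $\delta=\delta_{(m,n),(0,0)}$: $e^{(\mu)}_{11}(m,n)=\sum_{A}q^{A_1n}Q_{(3m,3n)+A}P_A+\tfrac12\mu\delta$; $e^{(\mu)}_{12}(m,n)=Q_{(3m+1,3n+1)}$; $e^{(\mu)}_{13}(m,n)=\sum_{B}q^{B_1n}Q_{(3m+2,3n+2)+B}P_B$;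 $e^{(\mu)}_{21}(m,n)=-q^{-mn}\mu P_{-(3m-1,3n-1)}-\sum_{A,A'}q^{nA'_1+A_2m+A_2A'_1}Q_{A+A'+(3m-1,3n-1)}P_AP_{A'}-\sum_{A,B}q^{nA_1+B_2m+B_2A_1}Q_{A+B+(3m-1,3n-1)}P_AP_B$; $e^{(\mu)}_{22}(m,n)=-\sum_{A}q^{A_2m}Q_{(3m,3n)+A}P_A-\sum_{B}q^{B_2m}Q_{(3m,3n)+B}P_B-\tfrac12\mu\delta$; $e^{(\mu)}_{23}(m,n)=-q^{-mn}\mu P_{-(3m+1,3n+1)}-\sum_{A,B}q^{nB_1+A_2m+A_2B_1}Q_{A+B+(3m+1,3n+1)}P_AP_B-\sum_{B,B'}q^{nB'_1+B_2m+B_2B'_1}Q_{B+B'+(3m+1,3n+1)}P_BP_{B'}$; $e^{(\mu)}_{31}(m,n)=\sum_{A}q^{A_1n}Q_{(3m-2,3n-2)+A}P_A$; $e^{(\mu)}_{32}(m,n)=Q_{(3m-1,3n-1)}$; $e^{(\mu)}_{33}(m,n)=\sum_{B}q^{B_1n}Q_{(3m,3n)+B}P_B+\tfrac12\mu\delta$; $D_1^{(\mu)}=\sum_AA_1Q_AP_A+\sum_BB_1Q_BP_B$; $D_2^{(\mu)}=\sum_AA_2Q_AP_A+\sum_BB_2Q_BP_B$. The representation $\pi$ of $\widetilde{\mathfrak{gl}_3(\mathbb{C}_q)}$ on $V$ is $\pi(E_{ij}(s^mt^n))=e^{(\mu)}_{ij}(m,n)$, $\pi(d_s)=D_1^{(\mu)}$,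 $\pi(d_t)=D_2^{(\mu)}$, $\pi(c_s)=\pi(c_t)=0$; write $x.v=\pi(x)v$. **The anti-involution.** The conjugate-linear map $\overline{\phantom{x}}:\mathbb{C}_q\to\mathbb{C}_q$ is $\overline{\lambda s^mt^n}=\bar\lambda t^{-n}s^{-m}=\bar\lambda q^{mn}s^{-m}t^{-n}$. $\omega$ is the conjugate-linear anti-involution of $\widetilde{\mathfrak{gl}_3(\mathbb{C}_q)}$ with $\omega(E_{ij}(a))=(-1)^{i+j}E_{ji}(\bar a)$ for $a\in\mathbb{C}_q$ and $\omega$ fixing $d_s,d_t,c_s,c_t$. **The form.** $\mathcal{B}$ is the basis of $V$ consisting of the vectors $E_{12}(\alpha_1)\cdots E_{12}(\alpha_k)E_{32}(\beta_1)\cdots E_{32}(\beta_l).1$ with $k,l\ge0$ and all $\alpha_i,\beta_j$ of the form $s^mt^n$ ($m,n\in\mathbb{Z}$); such a vector has level $\mathrm{lev}=(k,l)$ (the operators $E_{12}(\cdot),E_{32}(\cdot)$ all commute with one another). The form, linear in the first and conjugate-linear in the second argument, is defined by induction on the level: $(1,1)=1$; $(1,f)=0$ for $f\in\mathcal{B}$ with $\mathrm{lev}(f)\ne(0,0)$; and for $u'\in\mathcal{B}$, $v\in\mathcal{B}$ and $a$ of the form $s^mt^n$, $(E_{12}(a).u',v)=(u',\omega(E_{12}(a)).v)$ and $(E_{32}(a).u',v)=(u',\omega(E_{32}(a)).v)$. *)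

theory Defs
  imports "HOL-Analysis.Analysis" "HOL-Library.Poly_Mapping"
begin

definition cscale :: "complex \<Rightarrow> ('a \<Rightarrow>\<^sub>0 complex) \<Rightarrow> ('a \<Rightarrow>\<^sub>0 complex)"  (infixr \<open>*\<^sub>c\<close> 75)
  where "c *\<^sub>c f = Poly_Mapping.map ((*) c) f"


subsection \<open>The quantum torus and the Lie algebra\<close>

text \<open>
  The algebra with \<open>t s = q s t\<close> is realised on its basis \<open>s\<^sup>m t\<^sup>n\<close>, indexed by the pairs \<open>(m, n)\<close>.
  Its product is \<open>qmult q\<close>; the product \<open>*\<close> that the type inherits from the
  library is the commutative one and is never used on it.
\<close>

type_synonym qtorus = "(int \<times> int) \<Rightarrow>\<^sub>0 complex"

definition qmon :: "int \<Rightarrow> int \<Rightarrow> qtorus"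
  where "qmon m n = Poly_Mapping.single (m, n) 1"

definition qmult :: "complex \<Rightarrow> qtorus \<Rightarrow> qtorus \<Rightarrow> qtorus"
  where "qmult q a b =
    (\<Sum>x\<in>Poly_Mapping.keys a. \<Sum>y\<in>Poly_Mapping.keys b.
       Poly_Mapping.single (x + y)
         (q powi (snd x * fst y) * Poly_Mapping.lookup a x * Poly_Mapping.lookup b y))"

definition qbar :: "complex \<Rightarrow> qtorus \<Rightarrow> qtorus"
  where "qbar q a =
    (\<Sum>x\<in>Poly_Mapping.keys a.
       Poly_Mapping.single (- x) (cnj (Poly_Mapping.lookup a x) * q powi (fst x * snd x)))"

text \<open>
  An element is \<open>(M, \<gamma>\<^sub>s, \<gamma>\<^sub>t, \<eta>\<^sub>s, \<eta>\<^sub>t)\<close>, standing for the matrix \<open>M\<close> plus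
  \<open>\<gamma>\<^sub>s c\<^sub>s + \<gamma>\<^sub>t c\<^sub>t + \<eta>\<^sub>s d\<^sub>s + \<eta>\<^sub>t d\<^sub>t\<close>. The rows and columns are indexed by
  \<open>1, 2, 3\<close> of the three-element type \<open>3\<close>, in which \<open>3 = 0\<close>.
\<close>

type_synonym tgl3 = "(qtorus^3^3) \<times> complex \<times> complex \<times> complex \<times> complex"

definition E :: "3 \<Rightarrow> 3 \<Rightarrow> qtorus \<Rightarrow> tgl3"
  where "E i j a = ((\<chi> k l. if k = i \<and> l = j then a else 0), 0, 0, 0, 0)"

definition c_s :: tgl3 where "c_s = (0, 1, 0, 0, 0)"
definition c_t :: tgl3 where "c_t = (0, 0, 1, 0, 0)"
definition d_s :: tgl3 where "d_s = (0, 0, 0, 1, 0)"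
definition d_t :: tgl3 where "d_t = (0, 0, 0, 0, 1)"

fun tscale :: "complex \<Rightarrow> tgl3 \<Rightarrow> tgl3"
  where "tscale c (M, \<gamma>s, \<gamma>t, \<eta>s, \<eta>t) =
    ((\<chi> i j. c *\<^sub>c (M $ i $ j)), c * \<gamma>s, c * \<gamma>t, c * \<eta>s, c * \<eta>t)"

text \<open>
  \<open>qder w\<close> multiplies \<open>s\<^sup>m t\<^sup>n\<close> by \<open>w (m, n)\<close>, and \<open>qcocycle q w\<close> is the bilinear map with
  \<open>(s\<^sup>m t\<^sup>n, s\<^sup>m\<^sup>' t\<^sup>n\<^sup>') \<mapsto> q\<^bsup>n m'\<^esup> \<delta>\<^bsub>m+m',0\<^esub> \<delta>\<^bsub>n+n',0\<^esub> w (m, n)\<close>. Both are used with \<open>w = fst\<close> and \<open>w = snd\<close>.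
\<close>

definition qder :: "(int \<times> int \<Rightarrow> int) \<Rightarrow> qtorus \<Rightarrow> qtorus"
  where "qder w a =
    (\<Sum>x\<in>Poly_Mapping.keys a. Poly_Mapping.single x (of_int (w x) * Poly_Mapping.lookup a x))"

definition qcocycle :: "complex \<Rightarrow> (int \<times> int \<Rightarrow> int) \<Rightarrow> qtorus \<Rightarrow> qtorus \<Rightarrow> complex"
  where "qcocycle q w a b =
    (\<Sum>x\<in>Poly_Mapping.keys a.
       q powi (snd x * fst (- x)) * of_int (w x)
         * Poly_Mapping.lookup a x * Poly_Mapping.lookup b (- x))"

fun bracket :: "complex \<Rightarrow> tgl3 \<Rightarrow> tgl3 \<Rightarrow> tgl3"
  where "bracket q (M, \<gamma>s, \<gamma>t, \<eta>s, \<eta>t) (M', \<gamma>s', \<gamma>t', \<eta>s', \<eta>t') =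
    ((\<chi> i j. (\<Sum>k\<in>UNIV. qmult q (M $ i $ k) (M' $ k $ j))
            - (\<Sum>k\<in>UNIV. qmult q (M' $ i $ k) (M $ k $ j))
            + \<eta>s *\<^sub>c qder fst (M' $ i $ j) - \<eta>s' *\<^sub>c qder fst (M $ i $ j)
            + \<eta>t *\<^sub>c qder snd (M' $ i $ j) - \<eta>t' *\<^sub>c qder snd (M $ i $ j)),
     \<Sum>i\<in>UNIV. \<Sum>k\<in>UNIV. qcocycle q fst (M $ i $ k) (M' $ k $ i),
     \<Sum>i\<in>UNIV. \<Sum>k\<in>UNIV. qcocycle q snd (M $ i $ k) (M' $ k $ i),
     0, 0)"

text \<open>The sign \<open>(- 1)\<^bsup>i + j\<^esup>\<close> for \<open>i, j \<in> {1, 2, 3}\<close>: it is negative iff exactly one of the two is \<open>2\<close>.\<close>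

definition msign :: "3 \<Rightarrow> 3 \<Rightarrow> complex"
  where "msign i j = (if (i = 2) = (j = 2) then 1 else - 1)"

fun \<omega> :: "complex \<Rightarrow> tgl3 \<Rightarrow> tgl3"
  where "\<omega> q (M, \<gamma>s, \<gamma>t, \<eta>s, \<eta>t) =
    ((\<chi> i j. msign i j *\<^sub>c qbar q (M $ j $ i)), cnj \<gamma>s, cnj \<gamma>t, cnj \<eta>s, cnj \<eta>t)"


subsection \<open>The module\<close>

definition K1 :: "(int \<times> int) set"
  where "K1 = {(3 * m + 1, 3 * n + 1) | m n. True}"

definition Km1 :: "(int \<times> int) set"
  where "Km1 = {(3 * m - 1, 3 * n - 1) | m n. True}"

typedef kindex = "K1 \<union> Km1"
  by (auto simp: K1_def)

text \<open>The polynomial ring, a polynomial being a finitely supported function on monomials.\<close>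

type_synonym V = "(kindex \<Rightarrow>\<^sub>0 nat) \<Rightarrow>\<^sub>0 complex"

definition var :: "kindex \<Rightarrow> V"
  where "var x = Poly_Mapping.single (Poly_Mapping.single x 1) 1"

definition partial :: "kindex \<Rightarrow> V \<Rightarrow> V"
  where "partial x f =
    (\<Sum>\<alpha>\<in>Poly_Mapping.keys f.
       Poly_Mapping.single (\<alpha> - Poly_Mapping.single x 1)
         (of_nat (Poly_Mapping.lookup \<alpha> x) * Poly_Mapping.lookup f \<alpha>))"

text \<open>The indices \<open>(A\<^sub>1, A\<^sub>2)\<close>, by a formula that serves both sets.\<close>

definition fst3 :: "int \<times> int \<Rightarrow> int"  (\<open>_\<^bold>1\<close> [1000] 1000)
  where "A\<^bold>1 = (fst A + 1) div 3"

definition snd3 :: "int \<times> int \<Rightarrow> int"  (\<open>_\<^bold>2\<close> [1000] 1000)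
  where "A\<^bold>2 = (snd A + 1) div 3"

lemma fst3_snd3:
  "(3 * m + 1, 3 * n + 1)\<^bold>1 = m" "(3 * m + 1, 3 * n + 1)\<^bold>2 = n"
  "(3 * m - 1, 3 * n - 1)\<^bold>1 = m" "(3 * m - 1, 3 * n - 1)\<^bold>2 = n"
  by (simp_all add: fst3_def snd3_def)

text \<open>
  \<open>P\<close> and \<open>Q\<close> are meaningful only at points of \<open>K1 \<union> Km1\<close>, which are the only ones occurring below.
  The infinite sums are locally finite; \<open>sum'\<close> sums the nonzero terms.
\<close>

definition P :: "(int \<times> int \<Rightarrow> complex^2^2) \<Rightarrow> int \<times> int \<Rightarrow> V \<Rightarrow> V"
  where "P X A f = (X A $ 1 $ 1) *\<^sub>c partial (Abs_kindex A) f"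

definition Q :: "(int \<times> int \<Rightarrow> complex^2^2) \<Rightarrow> int \<times> int \<Rightarrow> V \<Rightarrow> V"
  where "Q X A f =
    (X A $ 2 $ 1) *\<^sub>c partial (Abs_kindex A) f + (X A $ 2 $ 2) *\<^sub>c (var (Abs_kindex A) * f)"

context
  fixes q \<mu> :: complex and X :: "int \<times> int \<Rightarrow> complex^2^2"
begin

definition e11 :: "int \<Rightarrow> int \<Rightarrow> V \<Rightarrow> V"
  where "e11 m n f =
    sum' (\<lambda>A. q powi (A\<^bold>1 * n) *\<^sub>c Q X ((3*m, 3*n) + A) (P X A f)) K1
    + (if (m, n) = (0, 0) then (1/2 * \<mu>) *\<^sub>c f else 0)"

definition e12 :: "int \<Rightarrow> int \<Rightarrow> V \<Rightarrow> V"
  where "e12 m n f = Q X (3*m + 1, 3*n + 1) f"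

definition e13 :: "int \<Rightarrow> int \<Rightarrow> V \<Rightarrow> V"
  where "e13 m n f =
    sum' (\<lambda>B. q powi (B\<^bold>1 * n) *\<^sub>c Q X ((3*m + 2, 3*n + 2) + B) (P X B f)) Km1"

definition e21 :: "int \<Rightarrow> int \<Rightarrow> V \<Rightarrow> V"
  where "e21 m n f =
    - ((q powi (- (m * n)) * \<mu>) *\<^sub>c P X (- (3*m - 1, 3*n - 1)) f)
    - sum' (\<lambda>(A, A'). q powi (n * A'\<^bold>1 + A\<^bold>2 * m + A\<^bold>2 * A'\<^bold>1) *\<^sub>c
              Q X (A + A' + (3*m - 1, 3*n - 1)) (P X A (P X A' f))) (K1 \<times> K1)
    - sum' (\<lambda>(A, B). q powi (n * A\<^bold>1 + B\<^bold>2 * m + B\<^bold>2 * A\<^bold>1) *\<^sub>c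
              Q X (A + B + (3*m - 1, 3*n - 1)) (P X A (P X B f))) (K1 \<times> Km1)"

definition e22 :: "int \<Rightarrow> int \<Rightarrow> V \<Rightarrow> V"
  where "e22 m n f =
    - sum' (\<lambda>A. q powi (A\<^bold>2 * m) *\<^sub>c Q X ((3*m, 3*n) + A) (P X A f)) K1
    - sum' (\<lambda>B. q powi (B\<^bold>2 * m) *\<^sub>c Q X ((3*m, 3*n) + B) (P X B f)) Km1
    - (if (m, n) = (0, 0) then (1/2 * \<mu>) *\<^sub>c f else 0)"

definition e23 :: "int \<Rightarrow> int \<Rightarrow> V \<Rightarrow> V"
  where "e23 m n f =
    - ((q powi (- (m * n)) * \<mu>) *\<^sub>c P X (- (3*m + 1, 3*n + 1)) f)
    - sum' (\<lambda>(A, B). q powi (n * B\<^bold>1 + A\<^bold>2 * m + A\<^bold>2 * B\<^bold>1) *\<^sub>c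
              Q X (A + B + (3*m + 1, 3*n + 1)) (P X A (P X B f))) (K1 \<times> Km1)
    - sum' (\<lambda>(B, B'). q powi (n * B'\<^bold>1 + B\<^bold>2 * m + B\<^bold>2 * B'\<^bold>1) *\<^sub>c
              Q X (B + B' + (3*m + 1, 3*n + 1)) (P X B (P X B' f))) (Km1 \<times> Km1)"

definition e31 :: "int \<Rightarrow> int \<Rightarrow> V \<Rightarrow> V"
  where "e31 m n f =
    sum' (\<lambda>A. q powi (A\<^bold>1 * n) *\<^sub>c Q X ((3*m - 2, 3*n - 2) + A) (P X A f)) K1"

definition e32 :: "int \<Rightarrow> int \<Rightarrow> V \<Rightarrow> V"
  where "e32 m n f = Q X (3*m - 1, 3*n - 1) f"

definition e33 :: "int \<Rightarrow> int \<Rightarrow> V \<Rightarrow> V"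
  where "e33 m n f =
    sum' (\<lambda>B. q powi (B\<^bold>1 * n) *\<^sub>c Q X ((3*m, 3*n) + B) (P X B f)) Km1
    + (if (m, n) = (0, 0) then (1/2 * \<mu>) *\<^sub>c f else 0)"

definition D1 :: "V \<Rightarrow> V"
  where "D1 f = sum' (\<lambda>A. of_int (A\<^bold>1) *\<^sub>c Q X A (P X A f)) K1
              + sum' (\<lambda>B. of_int (B\<^bold>1) *\<^sub>c Q X B (P X B f)) Km1"

definition D2 :: "V \<Rightarrow> V"
  where "D2 f = sum' (\<lambda>A. of_int (A\<^bold>2) *\<^sub>c Q X A (P X A f)) K1
              + sum' (\<lambda>B. of_int (B\<^bold>2) *\<^sub>c Q X B (P X B f)) Km1"

definition e :: "3 \<Rightarrow> 3 \<Rightarrow> int \<Rightarrow> int \<Rightarrow> V \<Rightarrow> V"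
  where "e i j m n f =
    (vector [vector [e11 m n f, e12 m n f, e13 m n f],
             vector [e21 m n f, e22 m n f, e23 m n f],
             vector [e31 m n f, e32 m n f, e33 m n f]] :: V^3^3) $ i $ j"

text \<open>The linear extension of \<open>E\<^sub>i\<^sub>j(s\<^sup>m t\<^sup>n) \<mapsto> e\<^sub>i\<^sub>j(m, n)\<close>, \<open>d\<^sub>s \<mapsto> D\<^sub>1\<close>, \<open>d\<^sub>t \<mapsto> D\<^sub>2\<close>, \<open>c\<^sub>s, c\<^sub>t \<mapsto> 0\<close>.\<close>

fun rep :: "tgl3 \<Rightarrow> V \<Rightarrow> V"
  where "rep (M, \<gamma>s, \<gamma>t, \<eta>s, \<eta>t) f =
    (\<Sum>i\<in>UNIV. \<Sum>j\<in>UNIV. \<Sum>x\<in>Poly_Mapping.keys (M $ i $ j).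
       Poly_Mapping.lookup (M $ i $ j) x *\<^sub>c e i j (fst x) (snd x) f)
    + \<eta>s *\<^sub>c D1 f + \<eta>t *\<^sub>c D2 f"


subsection \<open>The form\<close>

text \<open>
  \<open>has_level f k l\<close> says that \<open>f\<close> is a vector of the basis \<open>\<B>\<close>, written with \<open>k\<close> factors
  \<open>E\<^sub>1\<^sub>2(\<alpha>\<^sub>i)\<close> and \<open>l\<close> factors \<open>E\<^sub>3\<^sub>2(\<beta>\<^sub>j)\<close>.
\<close>

definition basis_vector :: "(int \<times> int) list \<Rightarrow> (int \<times> int) list \<Rightarrow> V"
  where "basis_vector \<alpha>s \<beta>s =
    foldr (\<lambda>(m, n). rep (E 1 2 (qmon m n))) \<alpha>s
      (foldr (\<lambda>(m, n). rep (E 3 2 (qmon m n))) \<beta>s 1)"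

definition has_level :: "V \<Rightarrow> nat \<Rightarrow> nat \<Rightarrow> bool"
  where "has_level f k l \<longleftrightarrow>
    (\<exists>\<alpha>s \<beta>s. length \<alpha>s = k \<and> length \<beta>s = l \<and> f = basis_vector \<alpha>s \<beta>s)"

definition \<B> :: "V set"
  where "\<B> = {f. \<exists>k l. has_level f k l}"

definition sesquilinear :: "(V \<Rightarrow> V \<Rightarrow> complex) \<Rightarrow> bool"
  where "sesquilinear F \<longleftrightarrow>
    (\<forall>u u' v. F (u + u') v = F u v + F u' v) \<and>
    (\<forall>c u v. F (c *\<^sub>c u) v = c * F u v) \<and>
    (\<forall>u v v'. F u (v + v') = F u v + F u v') \<and>
    (\<forall>c u v. F u (c *\<^sub>c v) = cnj c * F u v)"

definition level_recursive :: "(V \<Rightarrow> V \<Rightarrow> complex) \<Rightarrow> bool"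
  where "level_recursive F \<longleftrightarrow>
    sesquilinear F \<and>
    F 1 1 = 1 \<and>
    (\<forall>f k l. has_level f k l \<and> (k, l) \<noteq> (0, 0) \<longrightarrow> F 1 f = 0) \<and>
    (\<forall>u'\<in>\<B>. \<forall>v\<in>\<B>. \<forall>m n.
       F (rep (E 1 2 (qmon m n)) u') v = F u' (rep (\<omega> q (E 1 2 (qmon m n))) v) \<and>
       F (rep (E 3 2 (qmon m n)) u') v = F u' (rep (\<omega> q (E 3 2 (qmon m n))) v))"

definition the_form :: "V \<Rightarrow> V \<Rightarrow> complex"
  where "the_form = (THE F. level_recursive F)"

definition contravariant :: "(V \<Rightarrow> V \<Rightarrow> complex) \<Rightarrow> bool"
  where "contravariant F \<longleftrightarrow> (\<forall>x u v. F (rep x u) v = F u (rep (\<omega> q x) v))"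

end

definition hermitian :: "(V \<Rightarrow> V \<Rightarrow> complex) \<Rightarrow> bool"
  where "hermitian F \<longleftrightarrow> sesquilinear F \<and> (\<forall>u v. F v u = cnj (F u v))"


subsection \<open>The relations of the Lie algebra and the properties of \<open>\<omega>\<close>\<close>

lemma lookup_cscale: "Poly_Mapping.lookup (c *\<^sub>c f) x = c * Poly_Mapping.lookup f x"
  by (simp add: cscale_def Poly_Mapping.map.rep_eq when_def)

lemma cscale_simps:
  "c *\<^sub>c 0 = 0" "c *\<^sub>c (f + g) = c *\<^sub>c f + c *\<^sub>c g" "c *\<^sub>c (f - g) = c *\<^sub>c f - c *\<^sub>c g"
  "c *\<^sub>c (b *\<^sub>c f) = (c * b) *\<^sub>c f" "1 *\<^sub>c f = f" "0 *\<^sub>c f = 0"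
  "c *\<^sub>c Poly_Mapping.single x a = Poly_Mapping.single x (c * a)" "(- 1) *\<^sub>c f = - f"
  by (auto intro!: poly_mapping_eqI simp: lookup_cscale lookup_add lookup_minus lookup_single when_def algebra_simps)

lemma qmult_single:
  "qmult q (Poly_Mapping.single x a) (Poly_Mapping.single y b)
     = Poly_Mapping.single (x + y) (q powi (snd x * fst y) * a * b)"
  by (cases "a = 0"; cases "b = 0") (simp_all add: qmult_def)

lemma qmult_add_left: "qmult q (a + a') b = qmult q a b + qmult q a' b"
  unfolding qmult_def
  by (rule setsum_keys_plus_distrib) (simp_all add: algebra_simps single_add sum.distrib)

lemma qmult_add_right: "qmult q a (b + b') = qmult q a b + qmult q a b'"
  unfolding qmult_def sum.distrib[symmetric]
  by (intro sum.cong refl setsum_keys_plus_distrib) (simp_all add: algebra_simps single_add)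

lemma qbar_single:
  "qbar q (Poly_Mapping.single x a) = Poly_Mapping.single (- x) (cnj a * q powi (fst x * snd x))"
  by (cases "a = 0") (simp_all add: qbar_def)

lemma qbar_add: "qbar q (a + b) = qbar q a + qbar q b"
  unfolding qbar_def
  by (rule setsum_keys_plus_distrib) (simp_all add: algebra_simps single_add)

lemma qder_single: "qder w (Poly_Mapping.single x a) = Poly_Mapping.single x (of_int (w x) * a)"
  by (cases "a = 0") (simp_all add: qder_def)

lemma qder_add: "qder w (a + b) = qder w a + qder w b"
  unfolding qder_def
  by (rule setsum_keys_plus_distrib) (simp_all add: algebra_simps single_add)

lemma qcocycle_single:
  "qcocycle q w (Poly_Mapping.single x a) (Poly_Mapping.single y b)
     = (if x + y = 0 then q powi (snd x * fst y) * of_int (w x) * a * b else 0)"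
proof -
  have "(y = - x) = (x + y = 0)"
    by (metis add.inverse_unique add.right_inverse)
  then show ?thesis
    by (cases "a = 0") (auto simp: qcocycle_def lookup_single when_def)
qed

lemma qcocycle_add_left: "qcocycle q w (a + a') b = qcocycle q w a b + qcocycle q w a' b"
  unfolding qcocycle_def
  by (rule setsum_keys_plus_distrib) (simp_all add: algebra_simps)

lemma qcocycle_add_right: "qcocycle q w a (b + b') = qcocycle q w a b + qcocycle q w a b'"
  by (simp add: qcocycle_def lookup_add algebra_simps sum.distrib)

lemma qzero: "qmult q 0 b = 0" "qmult q a 0 = 0" "qbar q 0 = 0" "qder w 0 = 0"
  "qcocycle q w 0 b = 0" "qcocycle q w a 0 = 0"
  by (simp_all add: qmult_def qbar_def qder_def qcocycle_def)

lemma cnj_powi_unit: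
  assumes "cmod q = 1"
  shows "cnj (q powi k) = q powi (- k)"
proof -
  have "q * cnj q = 1" using assms by (simp add: complex_norm_square[symmetric])
  then have "cnj q = inverse q" by (metis inverse_unique)
  then show ?thesis
    by (simp add: power_int_def power_inverse)
qed

lemma poly_mapping_add_induct:
  fixes P :: "('a \<Rightarrow>\<^sub>0 complex) \<Rightarrow> bool"
  assumes "\<And>x c. P (Poly_Mapping.single x c)" "\<And>a b. P a \<Longrightarrow> P b \<Longrightarrow> P (a + b)"
  shows "P a"
proof -
  have "P 0" using assms(1)[of undefined 0] by simp
  have "finite (Poly_Mapping.keys a)" by simp
  have "P (\<Sum>x\<in>S. Poly_Mapping.single x (Poly_Mapping.lookup a x))" if "finite S" for S
    using that by induction (simp_all add: assms \<open>P 0\<close>)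
  moreover have "(\<Sum>x\<in>Poly_Mapping.keys a. Poly_Mapping.single x (Poly_Mapping.lookup a x)) = a"
    by (rule poly_mapping_eqI) (auto simp: lookup_sum lookup_single when_def in_keys_iff sum.delta)
  ultimately show ?thesis by (metis finite_keys)
qed

lemma qbar_qmult:
  assumes "cmod q = 1"
  shows "qbar q (qmult q a b) = qmult q (qbar q b) (qbar q a)"
proof -
  have [simp]: "q \<noteq> 0" using assms by auto
  show ?thesis
  proof (induction a rule: poly_mapping_add_induct)
    case (1 x c)
    show ?case
    proof (induction b rule: poly_mapping_add_induct)
      case (1 y d)
      show ?case
        by (simp add: qmult_single qbar_single cnj_powi_unit assms power_int_add algebra_simps
              del: complex_cnj_power_int)
           (simp add: power_int_minus field_simps)?
    qed (simp add: qmult_add_left qmult_add_right qbar_add)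
  qed (simp add: qmult_add_left qmult_add_right qbar_add)
qed


lemma qcocycle_qbar:
  assumes "cmod q = 1" and w: "w = fst \<or> w = snd"
  shows "cnj (qcocycle q w a b) = qcocycle q w (qbar q b) (qbar q a)"
proof (induction a rule: poly_mapping_add_induct)
  case (1 x c)
  show ?case
  proof (induction b rule: poly_mapping_add_induct)
    case (1 y d)
    have [simp]: "q \<noteq> 0" using assms by auto
    show ?case
    proof (cases "x + y = 0")
      case True
      then have y: "y = - x" by (simp add: eq_neg_iff_add_eq_0 add.commute)
      show ?thesis using w
        by (auto simp: y qcocycle_single qbar_single cnj_powi_unit assms simp del: complex_cnj_power_int)
           (simp_all add: power_int_minus field_simps)
    next
      case False
      then have "- y + - x \<noteq> 0" by (metis add.inverse_distrib_swap neg_equal_0_iff_equal)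
      with False show ?thesis by (simp add: qcocycle_single qbar_single)
    qed
  qed (simp add: qcocycle_add_left qcocycle_add_right qbar_add)
qed (simp add: qcocycle_add_left qcocycle_add_right qbar_add)

lemma qder_qbar: "w = fst \<or> w = snd \<Longrightarrow> qbar q (qder w a) = - qder w (qbar q a)"
proof (induction a rule: poly_mapping_add_induct)
  case (1 x c)
  then show ?case by (auto simp: qbar_single qder_single mult.assoc simp flip: single_uminus)
qed (simp add: qder_add qbar_add)

lemma cscale_qbar: "qbar q (c *\<^sub>c a) = cnj c *\<^sub>c qbar q a"
  by (induction a rule: poly_mapping_add_induct)
     (simp_all add: qbar_single cscale_simps qbar_add mult.assoc)

lemma cscale_qmult_left: "qmult q (c *\<^sub>c a) b = c *\<^sub>c qmult q a b"
proof (induction a rule: poly_mapping_add_induct)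
  case (1 x d)
  show ?case
    by (induction b rule: poly_mapping_add_induct)
       (simp_all add: qmult_single cscale_simps qmult_add_right ac_simps)
qed (simp add: cscale_simps qmult_add_left)

lemma cscale_qmult_right: "qmult q a (c *\<^sub>c b) = c *\<^sub>c qmult q a b"
proof (induction a rule: poly_mapping_add_induct)
  case (1 x d)
  show ?case
    by (induction b rule: poly_mapping_add_induct)
       (simp_all add: qmult_single cscale_simps qmult_add_right ac_simps)
qed (simp add: cscale_simps qmult_add_left)

lemma cscale_qcocycle_left: "qcocycle q w (c *\<^sub>c a) b = c * qcocycle q w a b"
proof (induction a rule: poly_mapping_add_induct)
  case (1 x d)
  show ?case
    by (induction b rule: poly_mapping_add_induct)
       (simp_all add: qcocycle_single cscale_simps qcocycle_add_right algebra_simps)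
qed (simp add: cscale_simps qcocycle_add_left algebra_simps)

lemma cscale_qcocycle_right: "qcocycle q w a (c *\<^sub>c b) = c * qcocycle q w a b"
  by (simp add: qcocycle_def lookup_cscale sum_distrib_left ac_simps)

lemma sum_E:
  "(\<Sum>r\<in>UNIV. qmult q (if p = i \<and> r = j then a else 0) (if r = k \<and> s = l then b else 0))
     = (if j = k \<and> p = i \<and> s = l then qmult q a b else 0)" for j k :: 3
proof -
  have "(\<Sum>r\<in>UNIV. qmult q (if p = i \<and> r = j then a else 0) (if r = k \<and> s = l then b else 0))
     = (\<Sum>r\<in>UNIV. if r = j then (if j = k \<and> p = i \<and> s = l then qmult q a b else 0) else 0)"
    by (rule sum.cong) (auto simp: qzero)
  then show ?thesis by simp
qed

lemma sum_E_cocycle: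
  "(\<Sum>p\<in>UNIV. \<Sum>r\<in>UNIV. qcocycle q w (if p = i \<and> r = j then a else 0) (if r = k \<and> p = l then b else 0))
     = (if j = k \<and> i = l then qcocycle q w a b else 0)" for i j k l :: 3
proof -
  have "(\<Sum>r\<in>UNIV. qcocycle q w (if p = i \<and> r = j then a else 0) (if r = k \<and> p = l then b else 0))
     = (\<Sum>r\<in>UNIV. if r = j then (if p = i then (if j = k \<and> i = l then qcocycle q w a b else 0) else 0) else 0)" for p
    by (rule sum.cong) (auto simp: qzero)
  then show ?thesis by simp
qed

lemma bracket_E_E:
  "bracket q (E i j (qmon m1 n1)) (E k l (qmon m2 n2)) =
     (if j = k then tscale (q powi (n1 * m2)) (E i l (qmon (m1 + m2) (n1 + n2))) else 0)
   - (if i = l then tscale (q powi (n2 * m1)) (E k j (qmon (m1 + m2) (n1 + n2))) else 0)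
   + (if j = k \<and> i = l \<and> m1 + m2 = 0 \<and> n1 + n2 = 0
      then tscale (q powi (n1 * m2)) (tscale (of_int m1) c_s + tscale (of_int n1) c_t) else 0)"
  by (cases "j = k"; cases "i = l")
     (simp_all add: E_def sum_E sum_E_cocycle c_s_def c_t_def qmon_def qmult_single qcocycle_single
        vec_eq_iff cscale_simps zero_prod_def qzero add.commute[of m2] add.commute[of n2])

lemma bracket_d:
  "bracket q d_s (E i j (qmon m n)) = tscale (of_int m) (E i j (qmon m n))"
  "bracket q d_t (E i j (qmon m n)) = tscale (of_int n) (E i j (qmon m n))"
  "bracket q d_s d_t = 0" "bracket q c_s x = 0" "bracket q c_t x = 0" "bracket q x c_s = 0" "bracket q x c_t = 0"
  by (cases x; auto simp: E_def d_s_def d_t_def c_s_def c_t_def qmon_def vec_eq_iff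
      cscale_simps zero_prod_def qzero qder_single)+

lemma \<omega>_simps:
  "\<omega> q (E i j a) = tscale (msign i j) (E j i (qbar q a))"
  "\<omega> q d_s = d_s" "\<omega> q d_t = d_t" "\<omega> q c_s = c_s" "\<omega> q c_t = c_t"
  by (auto simp: E_def d_s_def d_t_def c_s_def c_t_def vec_eq_iff cscale_simps qzero msign_def)

lemma \<omega>_conj_linear:
  "\<omega> q (x + y) = \<omega> q x + \<omega> q y" "\<omega> q (tscale c x) = tscale (cnj c) (\<omega> q x)"
  by (cases x; cases y; auto simp: vec_eq_iff qbar_add cscale_simps cscale_qbar mult.commute)+

lemma \<omega>_\<omega>:
  assumes "cmod q = 1" shows "\<omega> q (\<omega> q x) = x"
proof -
  have [simp]: "q \<noteq> 0" using assms by auto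
  have [simp]: "qbar q (qbar q a) = a" for a
    by (induction a rule: poly_mapping_add_induct)
       (simp_all add: qbar_add qbar_single cnj_powi_unit[OF assms] power_int_minus mult.assoc
         del: complex_cnj_power_int)
  show ?thesis
    by (cases x) (auto simp: vec_eq_iff cscale_qbar cscale_simps msign_def)
qed

lemma qbar_diff: "qbar q (a - b) = qbar q a - qbar q b"
  by (metis add_diff_cancel_right' diff_add_cancel qbar_add)

lemma qbar_sum: "qbar q (sum f S) = (\<Sum>x\<in>S. qbar q (f x))"
  by (induction S rule: infinite_finite_induct) (simp_all add: qzero qbar_add)

lemma cscale_sum: "c *\<^sub>c (sum f S) = (\<Sum>x\<in>S. c *\<^sub>c f x)"
  by (induction S rule: infinite_finite_induct) (simp_all add: cscale_simps)

lemma qder_cscale: "qder w (c *\<^sub>c a) = c *\<^sub>c qder w a"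
  by (induction a rule: poly_mapping_add_induct)
     (simp_all add: qder_single qder_add cscale_simps ac_simps)

lemma \<omega>_bracket:
  assumes "cmod q = 1"
  shows "\<omega> q (bracket q x y) = bracket q (\<omega> q y) (\<omega> q x)"
proof -
  have sgn: "msign i k * msign k j = msign i j" "msign k k = 1" "msign k j * msign i k = msign i j" for i j k
    by (auto simp: msign_def)
  have neg: "c *\<^sub>c (- f) = - (c *\<^sub>c f)" for c and f :: qtorus
    by (rule poly_mapping_eqI) (simp add: lookup_cscale)
  obtain M \<gamma>s \<gamma>t \<eta>s \<eta>t M' \<gamma>s' \<gamma>t' \<eta>s' \<eta>t'
    where [simp]: "x = (M, \<gamma>s, \<gamma>t, \<eta>s, \<eta>t)" "y = (M', \<gamma>s', \<gamma>t', \<eta>s', \<eta>t')"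
    by (cases x; cases y)
  show ?thesis
    by (simp add: vec_eq_iff qbar_qmult[OF assms] qbar_diff qbar_add qbar_sum cscale_sum
        cscale_simps(2-4) cscale_qmult_left cscale_qmult_right qcocycle_qbar[OF assms] sgn neg
        cscale_qcocycle_left cscale_qcocycle_right qder_cscale cscale_qbar qder_qbar mult.assoc[symmetric])
       (auto simp: mult.commute intro: sum.swap)
qed

lemma rep_simps:
  "rep q \<mu> X (E i j (qmon m n)) f = e q \<mu> X i j m n f"
  "rep q \<mu> X d_s f = D1 X f" "rep q \<mu> X d_t f = D2 X f"
  "rep q \<mu> X c_s f = 0" "rep q \<mu> X c_t f = 0"
proof -
  have "(\<Sum>x\<in>Poly_Mapping.keys a. Poly_Mapping.lookup a x *\<^sub>c e q \<mu> X k l (fst x) (snd x) f)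
      = (if l = j then (if k = i then e q \<mu> X i j m n f else 0) else 0)"
    if "a = (if k = i \<and> l = j then qmon m n else 0)" for a k l
    using that by (cases "k = i"; cases "l = j") (simp_all add: qmon_def cscale_simps)
  from this[OF refl] show "rep q \<mu> X (E i j (qmon m n)) f = e q \<mu> X i j m n f"
    by (simp add: E_def cscale_simps)
qed (simp_all add: d_s_def d_t_def c_s_def c_t_def cscale_simps)

end

theory Submission
  imports Defs
begin

text \<open>
  The operators \<open>Q\<close> and \<open>P\<close> satisfy the Weyl relations whatever the matrices \<open>X\<close> are, so \<open>V\<close> is the
  symmetric algebra of the space \<open>W\<close> of column vectors of length 2 over the quantum torus.
  The operators \<open>e\<^sub>i\<^sub>j\<close> with \<open>i, j \<noteq> 2\<close> act on it as the derivations extending left multiplication of columns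
  by \<open>2 \<times> 2\<close> matrices, \<open>- e\<^sub>2\<^sub>2\<close> as the one extending right multiplication by scalars (both up to the
  constant \<open>\<mu>/2\<close>), and for a row \<open>\<xi>\<close> the operator \<open>- e\<^sub>2\<^sub>\<bullet>\<close> is the second order operator \<open>D\<^sub>\<xi>\<close>
  that kills \<open>1\<close> and has \<open>[D\<^sub>\<xi>, w] = \<mu> \<tau>(\<xi> w) + L\<^bsub>w \<xi>\<^esub> + R\<^bsub>\<xi> w\<^esub>\<close> for \<open>w \<in> W\<close>, \<open>\<tau>\<close> being the coefficient of \<open>1\<close>.
  Two operators are equal if they agree at \<open>1\<close> and have the same commutators with \<open>W\<close>; in this way the
  associativity of the products \<open>w \<xi> w'\<close> yields all relations, in particular that the \<open>D\<^sub>\<xi>\<close> commute.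
  Hence sending each \<open>w\<close> to its adjoint \<open>D\<^bsub>w*\<^esub>\<close> extends to the symmetric algebra, which is
  the existence of the form. Contravariance is checked by induction on the level, first for \<open>L\<close>, \<open>R\<close>
  and the degree operators, then for \<open>D\<^sub>\<xi>\<close>, and the latter gives the Hermitian symmetry.
\<close>

section \<open>Polynomials\<close>

lemma cscale_add_left: "(a + b) *\<^sub>c f = a *\<^sub>c f + b *\<^sub>c f"
  by (rule poly_mapping_eqI) (simp add: lookup_cscale lookup_add algebra_simps)

lemma cscale_minus_left: "(- a) *\<^sub>c f = - (a *\<^sub>c f)"
  by (rule poly_mapping_eqI) (simp add: lookup_cscale)

lemma cscale_minus_right: "a *\<^sub>c (- f) = - (a *\<^sub>c f)"
  by (rule poly_mapping_eqI) (simp add: lookup_cscale)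

lemma cscale_mult_right: "x * (c *\<^sub>c f) = c *\<^sub>c (x * f)" for f :: V
proof -
  have *: "c *\<^sub>c g = Poly_Mapping.single 0 c * g" for g :: V
    by (induction g rule: poly_mapping_add_induct)
       (simp_all add: cscale_simps mult_single distrib_left)
  show ?thesis by (simp add: * ac_simps)
qed

section \<open>Complex-linear maps\<close>

definition lin :: "(('a \<Rightarrow>\<^sub>0 complex) \<Rightarrow> ('b \<Rightarrow>\<^sub>0 complex)) \<Rightarrow> bool"
  where "lin T \<longleftrightarrow> (\<forall>u v. T (u + v) = T u + T v) \<and> (\<forall>c u. T (c *\<^sub>c u) = c *\<^sub>c T u)"

lemma linI: "(\<And>u v. T (u + v) = T u + T v) \<Longrightarrow> (\<And>c u. T (c *\<^sub>c u) = c *\<^sub>c T u) \<Longrightarrow> lin T"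
  by (simp add: lin_def)

lemma
  assumes "lin T"
  shows lin_add: "T (u + v) = T u + T v" and lin_scale: "T (c *\<^sub>c u) = c *\<^sub>c T u"
    and lin_0: "T 0 = 0" and lin_minus: "T (- u) = - T u" and lin_diff: "T (u - v) = T u - T v"
proof -
  show *: "T (u + v) = T u + T v" "T (c *\<^sub>c u) = c *\<^sub>c T u" for u v c
    using assms by (auto simp: lin_def)
  show "T 0 = 0" using *(2)[of 0 0] by (simp add: cscale_simps)
  show **: "T (- u) = - T u" for u using *(2)[of "-1" u] by (simp add: cscale_simps)
  show "T (u - v) = T u - T v" using *(1)[of u "- v"] ** by simp
qed

lemma lin_sum: "lin T \<Longrightarrow> T (sum f S) = (\<Sum>i\<in>S. T (f i))"
  by (induction S rule: infinite_finite_induct) (simp_all add: lin_0 lin_add)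

lemma lin_const [intro!]: "lin (\<lambda>u. 0)" and lin_id [intro!]: "lin (\<lambda>u. u)"
  by (simp_all add: lin_def cscale_simps)

lemma lin_plus [intro!]: "lin T \<Longrightarrow> lin T' \<Longrightarrow> lin (\<lambda>u. T u + T' u)"
  and lin_uminus [intro!]: "lin T \<Longrightarrow> lin (\<lambda>u. - T u)"
  and lin_cscale [intro!]: "lin T \<Longrightarrow> lin (\<lambda>u. c *\<^sub>c T u)"
  and lin_compose: "lin T'' \<Longrightarrow> lin T \<Longrightarrow> lin (\<lambda>u. T'' (T u))"
  by (simp_all add: lin_def cscale_simps cscale_minus_right mult.commute)

lemma lin_If [intro!]: "lin T \<Longrightarrow> lin T' \<Longrightarrow> lin (\<lambda>u. if b then T u else T' u)"
  by (cases b) simp_all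

lemma lin_setsum [intro!]: "(\<And>i. i \<in> S \<Longrightarrow> lin (T i)) \<Longrightarrow> lin (\<lambda>u. \<Sum>i\<in>S. T i u)"
  by (induction S rule: infinite_finite_induct) auto

section \<open>Partial derivatives and induction over polynomials\<close>

lemma lin_partial: "lin (partial x)"
proof (rule linI)
  fix u v :: V and c :: complex
  show add: "partial x (u + v) = partial x u + partial x v" for u v
    unfolding partial_def
    by (rule setsum_keys_plus_distrib) (simp_all add: algebra_simps single_add)
  show "partial x (c *\<^sub>c u) = c *\<^sub>c partial x u"
  proof (induction u rule: poly_mapping_add_induct)
    case (1 \<alpha> d)
    show ?case
      by (cases "d = 0"; cases "c = 0") (simp_all add: partial_def cscale_simps mult.left_commute)
  qed (simp add: add cscale_simps)
qed

lemma partial_single: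
  "partial x (Poly_Mapping.single \<alpha> c) =
    Poly_Mapping.single (\<alpha> - Poly_Mapping.single x 1) (of_nat (Poly_Mapping.lookup \<alpha> x) * c)"
  by (cases "c = 0") (simp_all add: partial_def)

lemma partial_1: "partial x 1 = 0"
  using partial_single[of x 0 1] by simp

lemma var_mult_single:
  "var y * Poly_Mapping.single \<alpha> c = Poly_Mapping.single (Poly_Mapping.single y 1 + \<alpha>) c"
  by (simp add: var_def mult_single)

lemma partial_var_mult: "partial x (var y * f) = (if x = y then f else 0) + var y * partial x f"
proof (induction f rule: poly_mapping_add_induct)
  case (1 \<alpha> c)
  show ?case
  proof (cases "x = y")
    case True
    have "Poly_Mapping.single y 1 + (\<alpha> - Poly_Mapping.single y 1) = \<alpha>" if "Poly_Mapping.lookup \<alpha> y \<noteq> 0"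
      using that by (intro poly_mapping_eqI) (auto simp: lookup_add lookup_minus lookup_single when_def)
    with True show ?thesis
      by (cases "Poly_Mapping.lookup \<alpha> y = 0")
         (simp_all add: partial_single var_mult_single lookup_add single_add[symmetric] algebra_simps)
  next
    case False
    have "Poly_Mapping.single y 1 + \<alpha> - Poly_Mapping.single x 1
        = Poly_Mapping.single y 1 + (\<alpha> - Poly_Mapping.single x 1)" if "Poly_Mapping.lookup \<alpha> x \<noteq> 0"
      using that False by (intro poly_mapping_eqI) (auto simp: lookup_add lookup_minus lookup_single when_def)
    with False show ?thesis
      by (cases "Poly_Mapping.lookup \<alpha> x = 0")
         (simp_all add: partial_single var_mult_single lookup_add lookup_single)
  qed
qed (auto simp: distrib_left lin_add[OF lin_partial])

text \<open>Monomials span, and a nontrivial one has a variable to split off, so the induction runs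
  on the total degree.\<close>

lemma V_induct [case_names one var add scale]:
  assumes "R 1" "\<And>k u. R u \<Longrightarrow> R (var k * u)" "\<And>u v. R u \<Longrightarrow> R v \<Longrightarrow> R (u + v)"
    "\<And>c u. R u \<Longrightarrow> R (c *\<^sub>c u)"
  shows "R (f :: V)"
proof (induction f rule: poly_mapping_add_induct)
  case (1 \<alpha> c)
  have "R (Poly_Mapping.single \<alpha> 1)"
  proof (induction "\<Sum>k\<in>Poly_Mapping.keys \<alpha>. Poly_Mapping.lookup \<alpha> k" arbitrary: \<alpha> rule: less_induct)
    case less
    show ?case
    proof (cases "\<alpha> = 0")
      case True
      then show ?thesis using assms(1) by simp
    next
      case False
      then obtain k where k: "k \<in> Poly_Mapping.keys \<alpha>"
        by (metis all_not_in_conv keys_eq_empty)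
      define \<beta> where "\<beta> = \<alpha> - Poly_Mapping.single k 1"
      have \<alpha>: "\<alpha> = Poly_Mapping.single k 1 + \<beta>"
        unfolding \<beta>_def using k
        by (intro poly_mapping_eqI) (auto simp: lookup_add lookup_minus lookup_single when_def in_keys_iff)
      have "(\<Sum>j\<in>Poly_Mapping.keys \<beta>. Poly_Mapping.lookup \<beta> j) = (\<Sum>j\<in>Poly_Mapping.keys \<alpha>. Poly_Mapping.lookup \<beta> j)"
        by (rule sum.mono_neutral_left) (auto simp: in_keys_iff \<beta>_def lookup_minus)
      also have "\<dots> < (\<Sum>j\<in>Poly_Mapping.keys \<alpha>. Poly_Mapping.lookup \<alpha> j)"
      proof (rule sum_strict_mono_ex1)
        show "\<exists>j\<in>Poly_Mapping.keys \<alpha>. Poly_Mapping.lookup \<beta> j < Poly_Mapping.lookup \<alpha> j"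
          using k by (intro bexI[of _ k]) (simp_all add: \<beta>_def lookup_minus in_keys_iff)
      qed (simp_all add: \<beta>_def lookup_minus)
      finally have "R (Poly_Mapping.single \<beta> 1)" using less by blast
      then show ?thesis
        using assms(2)[of "Poly_Mapping.single \<beta> 1" k] by (simp add: var_mult_single \<alpha>)
    qed
  qed
  from assms(4)[OF this, of c] show ?case by (simp add: cscale_simps)
qed (rule assms(3))

lemma lin_var_eqI:
  assumes "lin S" "lin T" "S 1 = T 1"
    and "\<And>k u. S u = T u \<Longrightarrow> S (var k * u) = T (var k * u)"
  shows "S f = T f"
  by (induction f rule: V_induct) (simp_all add: assms lin_add[OF assms(1)] lin_add[OF assms(2)]
    lin_scale[OF assms(1)] lin_scale[OF assms(2)])

lemma partial_commute: "partial x (partial y f) = partial y (partial x f)"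
proof (rule lin_var_eqI[where S = "\<lambda>f. partial x (partial y f)" and T = "\<lambda>f. partial y (partial x f)"])
qed (simp_all add: lin_compose[OF lin_partial lin_partial] partial_1 partial_var_mult
  lin_add[OF lin_partial] lin_0[OF lin_partial])

text \<open>This makes the sums over \<open>K1\<close> and \<open>Km1\<close> finite on each
  vector.\<close>

lemma finite_partial: "finite {x. partial x f \<noteq> 0}"
proof (induction f rule: V_induct)
  case one
  then show ?case by (simp add: partial_1)
next
  case (var k u)
  have "{x. partial x (var k * u) \<noteq> 0} \<subseteq> insert k {x. partial x u \<noteq> 0}"
    by (auto simp: partial_var_mult)
  with var show ?case by (meson finite_insert finite_subset)
next
  case (add u v)
  have "{x. partial x (u + v) \<noteq> 0} \<subseteq> {x. partial x u \<noteq> 0} \<union> {x. partial x v \<noteq> 0}"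
    by (auto simp: lin_add[OF lin_partial])
  with add show ?case by (meson finite_UnI finite_subset)
next
  case (scale c u)
  have "{x. partial x (c *\<^sub>c u) \<noteq> 0} \<subseteq> {x. partial x u \<noteq> 0}"
    by (auto simp: lin_scale[OF lin_partial] cscale_simps)
  with scale show ?case by (meson finite_subset)
qed

subsection \<open>Evaluation at commuting operators\<close>

text \<open>The exponent vector is read as a multiset: for commuting \<open>T\<close> the fold does
  not depend on an order of the factors.\<close>

definition mon_op :: "(kindex \<Rightarrow> 'a \<Rightarrow> 'a) \<Rightarrow> (kindex \<Rightarrow>\<^sub>0 nat) \<Rightarrow> 'a \<Rightarrow> 'a"
  where "mon_op T \<alpha> v = fold_mset T v (Abs_multiset (Poly_Mapping.lookup \<alpha>))"

lemma count_lookup: "count (Abs_multiset (Poly_Mapping.lookup \<alpha>)) = Poly_Mapping.lookup \<alpha>" for \<alpha> :: "'a \<Rightarrow>\<^sub>0 nat"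
  using finite_lookup[of \<alpha>] by (intro count_Abs_multiset) simp

lemma mon_op_0: "mon_op T 0 v = v"
proof -
  have "Abs_multiset (Poly_Mapping.lookup (0 :: kindex \<Rightarrow>\<^sub>0 nat)) = {#}"
    by (rule multiset_eqI) (simp add: count_lookup)
  then show ?thesis by (simp add: mon_op_def)
qed

text \<open>The new factor may be put outermost, as \<open>ev\<close> needs it, or innermost, as
  \<open>pairing\<close> needs it.\<close>

lemma mon_op_add:
  assumes "\<And>x y v. T x (T y v) = T y (T x v)"
  shows "mon_op T (Poly_Mapping.single k 1 + \<alpha>) v = T k (mon_op T \<alpha> v)"
    and "mon_op T (Poly_Mapping.single k 1 + \<alpha>) v = mon_op T \<alpha> (T k v)"
proof -
  interpret comp_fun_commute T
    by standard (auto simp: assms)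
  have "Abs_multiset (Poly_Mapping.lookup (Poly_Mapping.single k 1 + \<alpha>))
      = add_mset k (Abs_multiset (Poly_Mapping.lookup \<alpha>))"
    by (rule multiset_eqI) (simp add: count_lookup lookup_add lookup_single when_def)
  then show "mon_op T (Poly_Mapping.single k 1 + \<alpha>) v = T k (mon_op T \<alpha> v)"
    "mon_op T (Poly_Mapping.single k 1 + \<alpha>) v = mon_op T \<alpha> (T k v)"
    by (simp_all add: mon_op_def fold_mset_fun_left_comm)
qed

lemma lin_mon_op:
  assumes "\<And>x y v. T x (T y v) = T y (T x v)" "\<And>k. lin (T k)"
  shows "lin (mon_op T \<alpha>)"
proof -
  interpret comp_fun_commute T
    by standard (auto simp: assms)
  have "lin (\<lambda>v. fold_mset T v M)" for M
    by (induction M) (auto intro: lin_compose assms(2))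
  then show ?thesis by (simp add: mon_op_def[abs_def])
qed

definition ev :: "(kindex \<Rightarrow> V \<Rightarrow> V) \<Rightarrow> V \<Rightarrow> V"
  where "ev T f = (\<Sum>\<alpha>\<in>Poly_Mapping.keys f. Poly_Mapping.lookup f \<alpha> *\<^sub>c mon_op T \<alpha> 1)"

lemma ev_single: "ev T (Poly_Mapping.single \<alpha> c) = c *\<^sub>c mon_op T \<alpha> 1"
  by (cases "c = 0") (simp_all add: ev_def cscale_simps)

lemma lin_ev: "lin (ev T)"
proof (rule linI)
  fix u v :: V and c :: complex
  show add: "ev T (u + v) = ev T u + ev T v" for u v
    unfolding ev_def
    by (rule setsum_keys_plus_distrib) (simp_all add: cscale_simps cscale_add_left)
  show "ev T (c *\<^sub>c u) = c *\<^sub>c ev T u"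
    by (induction u rule: poly_mapping_add_induct) (simp_all add: ev_single cscale_simps add)
qed

lemma ev_1: "ev T 1 = 1"
  using ev_single[of T 0 1] by (simp add: mon_op_0 cscale_simps)

lemma ev_var_mult:
  assumes "\<And>x y v. T x (T y v) = T y (T x v)" "\<And>k. lin (T k)"
  shows "ev T (var k * f) = T k (ev T f)"
  by (induction f rule: poly_mapping_add_induct)
     (simp_all add: ev_single var_mult_single mon_op_add(1)[of T, OF assms(1)] lin_scale[OF assms(2)]
       lin_add[OF assms(2)] lin_add[OF lin_ev] distrib_left
       del: One_nat_def)

section \<open>Differential operators on the Fock space\<close>

text \<open>The variables with index in \<open>K1\<close> are marked by \<open>True\<close>, those with index in \<open>Km1\<close> by \<open>False\<close>.\<close>

type_synonym idx = "bool \<times> int \<times> int"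

fun pt :: "idx \<Rightarrow> int \<times> int"
  where "pt (s, m, n) = (if s then (3 * m + 1, 3 * n + 1) else (3 * m - 1, 3 * n - 1))"

lemma pt_eq_iff: "pt i = pt j \<longleftrightarrow> i = j"
proof (cases i; cases j)
  fix s m n s' m' n'
  assume "i = (s, m, n)" "j = (s', m', n')"
  moreover have "3 * m + 1 \<noteq> 3 * m' - 1" "3 * m - 1 \<noteq> 3 * m' + 1" by presburger+
  ultimately show ?thesis by auto
qed

lemma range_pt: "pt ` UNIV = K1 \<union> Km1"
proof -
  have "pt (True, m, n) \<in> K1" "pt (False, m, n) \<in> Km1" for m n
    by (auto simp: K1_def Km1_def)
  moreover have "A \<in> range pt" if "A \<in> K1 \<union> Km1" for A
  proof -
    from that consider m n where "A = pt (True, m, n)" | m n where "A = pt (False, m, n)"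
      by (auto simp: K1_def Km1_def)
    then show ?thesis by cases (simp_all del: pt.simps)
  qed
  moreover have "pt i \<in> K1 \<union> Km1" for i
    by (cases i; cases "fst i") (auto simp: K1_def Km1_def)
  ultimately show ?thesis by blast
qed

declare pt.simps [simp del]

lemma pt_in: "pt i \<in> K1 \<union> Km1"
  using range_pt by blast

lemma Abs_kindex_pt_eq_iff: "Abs_kindex (pt i) = Abs_kindex (pt j) \<longleftrightarrow> i = j"
  by (metis Abs_kindex_inject pt_in pt_eq_iff)

lemma kindex_pt: obtains i where "k = Abs_kindex (pt i)"
  by (metis Abs_kindex_cases image_iff range_pt)

locale fock =
  fixes q :: complex and \<mu> :: real and X :: "int \<times> int \<Rightarrow> complex^2^2"
  assumes cmod_q: "cmod q = 1"
    and X: "\<forall>A \<in> K1 \<union> Km1. det (X A) = 1 \<and> X A $ 1 $ 2 = 0"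
begin

lemma q_nz [simp]: "q \<noteq> 0"
  using cmod_q by auto

section \<open>Weyl relations and generation of the space from \<open>1\<close>\<close>

definition qq :: "idx \<Rightarrow> V \<Rightarrow> V" where "qq i = Q X (pt i)"
definition pp :: "idx \<Rightarrow> V \<Rightarrow> V" where "pp i = P X (pt i)"

lemma X_diag: "X (pt i) $ 1 $ 1 * X (pt i) $ 2 $ 2 = 1" "X (pt i) $ 2 $ 2 * X (pt i) $ 1 $ 1 = 1"
proof -
  have "det (X (pt i)) = 1" "X (pt i) $ 1 $ 2 = 0"
    using X pt_in[of i] by blast+
  then show "X (pt i) $ 1 $ 1 * X (pt i) $ 2 $ 2 = 1" "X (pt i) $ 2 $ 2 * X (pt i) $ 1 $ 1 = 1"
    by (simp_all add: det_2 mult.commute)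
qed

lemma lin_pp: "lin (pp i)"
  by (rule linI) (simp_all add: pp_def P_def lin_add[OF lin_partial] lin_scale[OF lin_partial]
    cscale_simps mult.commute)

lemma lin_qq: "lin (qq i)"
  by (rule linI) (simp_all add: qq_def Q_def lin_add[OF lin_partial] lin_scale[OF lin_partial]
    cscale_simps mult.commute[where 'a = complex] distrib_left cscale_mult_right add.left_commute add.assoc)

lemma pp_1: "pp i 1 = 0"
  by (simp add: pp_def P_def partial_1 cscale_simps)

text \<open>The derivative part of \<open>qq j\<close> commutes with \<open>pp i\<close>; the rest
  contributes \<open>a d = 1\<close>.\<close>

lemma pp_qq: "pp i (qq j u) = (if i = j then u else 0) + qq j (pp i u)"
  by (cases "i = j")
     (auto simp: pp_def qq_def P_def Q_def lin_add[OF lin_partial] lin_scale[OF lin_partial]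
      cscale_simps partial_var_mult Abs_kindex_pt_eq_iff partial_commute cscale_mult_right X_diag mult.commute[where 'a = complex] add.assoc add.left_commute)

lemma pp_commute: "pp i (pp j u) = pp j (pp i u)"
  by (simp add: pp_def P_def lin_scale[OF lin_partial] cscale_simps partial_commute mult.commute)

lemma qq_commute: "qq i (qq j u) = qq j (qq i u)"
  by (cases "i = j")
     (auto simp: qq_def Q_def lin_add[OF lin_partial] lin_scale[OF lin_partial] distrib_left
      cscale_simps partial_var_mult Abs_kindex_pt_eq_iff partial_commute cscale_mult_right
      mult.commute[where 'a = complex] mult.left_commute[where 'a = V] add.assoc add.left_commute add.commute)

lemma finite_pp: "finite {i. pp i u \<noteq> 0}"
proof (rule finite_imageD)
  have "(\<lambda>i. Abs_kindex (pt i)) ` {i. pp i u \<noteq> 0} \<subseteq> {x. partial x u \<noteq> 0}"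
    by (auto simp: pp_def P_def cscale_simps)
  then show "finite ((\<lambda>i. Abs_kindex (pt i)) ` {i. pp i u \<noteq> 0})"
    using finite_partial finite_subset by blast
qed (simp add: inj_on_def Abs_kindex_pt_eq_iff)

inductive qspan :: "V \<Rightarrow> bool"
  where one: "qspan 1"
  | qq: "qspan u \<Longrightarrow> qspan (qq i u)"
  | add: "qspan u \<Longrightarrow> qspan v \<Longrightarrow> qspan (u + v)"
  | scale: "qspan u \<Longrightarrow> qspan (c *\<^sub>c u)"

lemma qspan_pp: "qspan u \<Longrightarrow> qspan (pp i u)"
proof (induction rule: qspan.induct)
  case one
  show ?case using qspan.scale[OF qspan.one, of 0] by (simp add: pp_1 cscale_simps)
next
  case (qq u j)
  then show ?case by (auto simp: pp_qq intro: qspan.intros)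
qed (simp_all add: qspan.intros lin_add[OF lin_pp] lin_scale[OF lin_pp])

lemma qspan_UNIV: "qspan f"
proof (induction f rule: V_induct)
  case (var k u)
  obtain i where k: "k = Abs_kindex (pt i)" by (rule kindex_pt)
  let ?a = "X (pt i) $ 1 $ 1" and ?c = "X (pt i) $ 2 $ 1"
  \<comment> \<open>The definition of \<open>Q\<close> solved for the variable by
    \<open>a d = 1\<close>; the correction stays in the span by \<open>qspan_pp\<close>.\<close>
  have "var k * u = ?a *\<^sub>c qq i u + (- ?c) *\<^sub>c pp i u"
    by (simp add: qq_def Q_def pp_def P_def k cscale_simps X_diag cscale_minus_left mult.commute[where 'a = complex])
  then show ?case using var qspan_pp by (metis qspan.qq qspan.add qspan.scale)
qed (auto intro: qspan.intros)

text \<open>Reduces an identity of linear operators to its value at \<open>1\<close> and to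
  commutators with the \<open>qq i\<close>.\<close>

lemma qq_induct [case_names one qq add scale]:
  assumes "R 1" "\<And>r a u. R u \<Longrightarrow> R (qq (r, a) u)" "\<And>u v. R u \<Longrightarrow> R v \<Longrightarrow> R (u + v)"
    "\<And>c u. R u \<Longrightarrow> R (c *\<^sub>c u)"
  shows "R f"
  using qspan_UNIV[of f] by (induction rule: qspan.induct) (auto simp: assms)

section \<open>Operators that differentiate first, and their commutators\<close>

definition Der :: "(idx \<Rightarrow> V \<Rightarrow> V) \<Rightarrow> V \<Rightarrow> V"
  where "Der \<Phi> u = (\<Sum>i | pp i u \<noteq> 0. \<Phi> i (pp i u))"

lemma Der_superset:
  assumes "\<And>i. lin (\<Phi> i)" "finite S" "{i. pp i u \<noteq> 0} \<subseteq> S"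
  shows "Der \<Phi> u = (\<Sum>i\<in>S. \<Phi> i (pp i u))"
  unfolding Der_def using assms by (intro sum.mono_neutral_left) (auto simp: lin_0)

lemma lin_Der:
  assumes "\<And>i. lin (\<Phi> i)"
  shows "lin (Der \<Phi>)"
proof (rule linI)
  fix u v c
  let ?S = "{i. pp i u \<noteq> 0} \<union> {i. pp i v \<noteq> 0}"
  have S: "finite ?S" "{i. pp i (u + v) \<noteq> 0} \<subseteq> ?S" "{i. pp i (c *\<^sub>c u) \<noteq> 0} \<subseteq> {i. pp i u \<noteq> 0}"
    by (auto simp: finite_pp lin_add[OF lin_pp] lin_scale[OF lin_pp] cscale_simps)
  then show "Der \<Phi> (u + v) = Der \<Phi> u + Der \<Phi> v"
    by (subst (1 2 3) Der_superset[OF assms, of ?S])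
       (auto simp: lin_add[OF lin_pp] lin_add[OF assms] sum.distrib)
  show "Der \<Phi> (c *\<^sub>c u) = c *\<^sub>c Der \<Phi> u"
    using S(3) by (subst (1 2) Der_superset[OF assms, of "{i. pp i u \<noteq> 0}"])
       (auto simp: lin_scale[OF lin_pp] lin_scale[OF assms] cscale_sum finite_pp)
qed

lemma Der_1: "Der \<Phi> 1 = 0"
  by (simp add: Der_def pp_1)

text \<open>Leibniz rule: \<open>pp i\<close> meeting \<open>qq j\<close> leaves
  \<open>\<Phi> j\<close>, and moving \<open>qq j\<close> past \<open>\<Phi> i\<close> leaves a
  commutator. The last term vanishes if the \<open>\<Phi> i\<close> are multiples of some
  \<open>qq\<close>; for \<open>Dop\<close> it has order one.\<close>

lemma Der_qq:
  assumes "\<And>i. lin (\<Phi> i)"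
  shows "Der \<Phi> (qq j u) = qq j (Der \<Phi> u) + \<Phi> j u + Der (\<lambda>i v. \<Phi> i (qq j v) - qq j (\<Phi> i v)) u"
proof -
  let ?S = "insert j {i. pp i u \<noteq> 0}"
  have S: "finite ?S" "{i. pp i (qq j u) \<noteq> 0} \<subseteq> ?S"
    by (auto simp: finite_pp pp_qq lin_0[OF lin_qq] split: if_splits)
  have lin': "lin (\<lambda>v. \<Phi> i (qq j v) - qq j (\<Phi> i v))" for i
    by (rule linI) (simp_all add: lin_add[OF assms] lin_add[OF lin_qq] lin_scale[OF assms] lin_scale[OF lin_qq] cscale_simps)
  have "Der \<Phi> (qq j u) = (\<Sum>i\<in>?S. \<Phi> i (pp i (qq j u)))"
    by (rule Der_superset[OF assms S])
  also have "\<dots> = (\<Sum>i\<in>?S. (if i = j then \<Phi> i u else 0) + (qq j (\<Phi> i (pp i u))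
      + (\<Phi> i (qq j (pp i u)) - qq j (\<Phi> i (pp i u)))))"
    by (rule sum.cong) (auto simp: pp_qq lin_add[OF assms] lin_0[OF assms])
  also have "\<dots> = \<Phi> j u + (qq j (Der \<Phi> u) + Der (\<lambda>i v. \<Phi> i (qq j v) - qq j (\<Phi> i v)) u)"
    by (subst (1 2) Der_superset[of _ ?S])
      (use S assms lin' in \<open>auto simp only: sum.distrib lin_sum[OF lin_qq] sum.delta if_True insert_iff simp_thms\<close>)
  finally show ?thesis by (simp add: ac_simps)
qed

lemma Der_cong: "(\<And>i v. \<Phi> i v = \<Psi> i v) \<Longrightarrow> Der \<Phi> u = Der \<Psi> u"
  by (simp add: Der_def)

lemma Der_zero: "(\<And>i v. \<Phi> i v = 0) \<Longrightarrow> Der \<Phi> u = 0"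
  by (simp add: Der_def)

lemma Der_cscale: "Der (\<lambda>i v. c *\<^sub>c \<Phi> i v) u = c *\<^sub>c Der \<Phi> u"
  by (simp add: Der_def cscale_sum)

text \<open>
  For \<open>a = (m, n)\<close> let \<open>z\<^sup>a = s\<^sup>m t\<^sup>n\<close>, so that \<open>z\<^sup>c z\<^sup>a = q\<^bsup>snd c * fst a\<^esup> z\<^bsup>c + a\<^esup>\<close>, and let \<open>qq (t, a)\<close> stand for the
  column with \<open>z\<^sup>a\<close> at position \<open>t\<close>. Then \<open>Lop s' s c\<close> and \<open>Rop c\<close> are left multiplication by \<open>E\<^bsub>s's\<^esub>(z\<^sup>c)\<close> and right
  multiplication by \<open>z\<^sup>c\<close>, and \<open>Dop s c\<close> is \<open>D\<^sub>\<xi>\<close> for the row \<open>\<xi>\<close> with \<open>z\<^sup>c\<close> at position \<open>s\<close>.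
\<close>

definition Lop :: "bool \<Rightarrow> bool \<Rightarrow> int \<times> int \<Rightarrow> V \<Rightarrow> V"
  where "Lop s' s c = Der (\<lambda>(t, a) u. if t = s then q powi (snd c * fst a) *\<^sub>c qq (s', c + a) u else 0)"

definition Rop :: "int \<times> int \<Rightarrow> V \<Rightarrow> V"
  where "Rop c = Der (\<lambda>(t, a) u. q powi (snd a * fst c) *\<^sub>c qq (t, a + c) u)"

text \<open>With \<open>fst\<close> and \<open>snd\<close> as \<open>h\<close> these are the degree
  operators \<open>D1\<close> and \<open>D2\<close>.\<close>

definition Nop :: "(int \<times> int \<Rightarrow> int) \<Rightarrow> V \<Rightarrow> V"
  where "Nop h = Der (\<lambda>(t, a) u. of_int (h a) *\<^sub>c qq (t, a) u)"

text \<open>\<open>\<mu>\<close> times the coefficient of \<open>1\<close> in the product of the monomials with exponents \<open>c\<close> and \<open>a\<close>.\<close>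

definition kap :: "int \<times> int \<Rightarrow> int \<times> int \<Rightarrow> complex"
  where "kap c a = (if a + c = 0 then \<mu> * q powi (snd c * fst a) else 0)"

definition Dop :: "bool \<Rightarrow> int \<times> int \<Rightarrow> V \<Rightarrow> V"
  where "Dop s c = Der (\<lambda>(t, a) u.
    if t = s then kap c a *\<^sub>c u + q powi (snd c * fst a) *\<^sub>c Rop (c + a) u else 0)"

lemma lin_Lop: "lin (Lop s' s c)" and lin_Rop: "lin (Rop c)" and lin_Nop: "lin (Nop h)"
  unfolding Lop_def Rop_def Nop_def by (auto intro!: lin_Der lin_qq split: prod.splits)

lemma lin_Dop: "lin (Dop s c)"
  unfolding Dop_def by (auto intro!: lin_Der lin_Rop split: prod.splits)

lemmas lin_ops = lin_qq lin_Lop lin_Rop lin_Nop lin_Dop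

lemmas lin_ops_simps = lin_ops[THEN lin_add] lin_ops[THEN lin_scale] lin_ops[THEN lin_0]
  lin_ops[THEN lin_minus] lin_ops[THEN lin_diff]

lemma ops_1: "Lop s' s c 1 = 0" "Rop c 1 = 0" "Nop h 1 = 0" "Dop s c 1 = 0"
  by (simp_all add: Lop_def Rop_def Nop_def Dop_def Der_1)

lemma Lop_qq: "Lop s' s c (qq (t, a) u) = qq (t, a) (Lop s' s c u)
    + (if t = s then q powi (snd c * fst a) *\<^sub>c qq (s', c + a) u else 0)"
  unfolding Lop_def
  by (subst Der_qq) (auto intro!: lin_qq Der_zero simp: lin_ops_simps qq_commute split: prod.splits)

lemma Rop_qq: "Rop c (qq (t, a) u) = qq (t, a) (Rop c u) + q powi (snd a * fst c) *\<^sub>c qq (t, a + c) u"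
  unfolding Rop_def
  by (subst Der_qq) (auto intro!: lin_qq Der_zero simp: lin_ops_simps qq_commute split: prod.splits)

lemma Nop_qq: "Nop h (qq (t, a) u) = qq (t, a) (Nop h u) + of_int (h a) *\<^sub>c qq (t, a) u"
  unfolding Nop_def
  by (subst Der_qq) (auto intro!: lin_qq Der_zero simp: lin_ops_simps qq_commute split: prod.splits)

text \<open>The commutator of \<open>Rop\<close> with a column multiplies that column from the
  right; summed against the derivatives this is the \<open>Lop\<close> term.\<close>

lemma Dop_qq: "Dop s c (qq (t, a) u) = qq (t, a) (Dop s c u)
    + (if t = s then kap c a *\<^sub>c u + q powi (snd c * fst a) *\<^sub>c Rop (c + a) u else 0)
    + q powi (snd a * fst c) *\<^sub>c Lop t s (a + c) u"
proof -
  let ?\<Phi> = "\<lambda>(t, a) u.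
    if t = s then kap c a *\<^sub>c u + q powi (snd c * fst a) *\<^sub>c Rop (c + a) u else 0"
  have "Der (\<lambda>i v. ?\<Phi> i (qq (t, a) v) - qq (t, a) (?\<Phi> i v)) u = q powi (snd a * fst c) *\<^sub>c Lop t s (a + c) u"
    unfolding Lop_def Der_cscale[symmetric]
    by (rule Der_cong) (auto simp: lin_ops_simps Rop_qq cscale_simps power_int_add algebra_simps split: prod.splits)
  moreover have "lin (?\<Phi> i)" for i
    by (auto intro!: lin_Rop split: prod.splits)
  ultimately show ?thesis
    unfolding Dop_def by (subst Der_qq) auto
qed

subsection \<open>Commutation relations\<close>

lemmas coeff_simps = lookup_add lookup_minus lookup_cscale power_int_add

lemma Lop_Lop: "Lop s' s c (Lop t' t d u) = Lop t' t d (Lop s' s c u)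
   + (if s = t' then q powi (snd c * fst d) *\<^sub>c Lop s' t (c + d) u else 0)
   - (if t = s' then q powi (snd d * fst c) *\<^sub>c Lop t' s (c + d) u else 0)"
proof (induction u rule: qq_induct)
  case (qq r a u)
  show ?case
    using qq
    by (cases s; cases s'; cases t; cases t'; cases r)
      (simp_all add: Lop_qq lin_ops_simps,
        (rule poly_mapping_eqI; simp add: coeff_simps algebra_simps)+)
qed (simp add: ops_1 lin_ops_simps cscale_simps; simp add: algebra_simps)+

lemma Rop_Lop: "Rop c (Lop t' t d u) = Lop t' t d (Rop c u)"
proof (induction u rule: qq_induct)
  case (qq r a u)
  show ?case
    by (cases "r = t"; simp add: qq Lop_qq Rop_qq lin_ops_simps;
        rule poly_mapping_eqI; simp add: coeff_simps algebra_simps)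
qed (simp add: ops_1 lin_ops_simps cscale_simps; simp add: algebra_simps)+

text \<open>Right multiplication reverses products, whence the opposite commutator.\<close>

lemma Rop_Rop: "Rop c (Rop d u) = Rop d (Rop c u)
    + q powi (snd d * fst c) *\<^sub>c Rop (d + c) u - q powi (snd c * fst d) *\<^sub>c Rop (d + c) u"
proof (induction u rule: qq_induct)
  case (qq r a u)
  show ?case
    by (simp add: qq Rop_qq lin_ops_simps; rule poly_mapping_eqI; simp add: coeff_simps algebra_simps)
qed (simp add: ops_1 lin_ops_simps cscale_simps; simp add: algebra_simps)+

lemma Nop_Lop:
  assumes "\<And>a b. h (a + b) = h a + h b"
  shows "Nop h (Lop s' s c u) = Lop s' s c (Nop h u) + of_int (h c) *\<^sub>c Lop s' s c u"
proof (induction u rule: qq_induct)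
  case (qq r a u)
  show ?case
    by (cases "r = s"; simp add: qq Lop_qq Nop_qq lin_ops_simps;
        rule poly_mapping_eqI; simp add: assms coeff_simps algebra_simps)
qed (simp add: ops_1 lin_ops_simps cscale_simps; simp add: algebra_simps)+

lemma Nop_Rop:
  assumes "\<And>a b. h (a + b) = h a + h b"
  shows "Nop h (Rop c u) = Rop c (Nop h u) + of_int (h c) *\<^sub>c Rop c u"
proof (induction u rule: qq_induct)
  case (qq r a u)
  show ?case
    by (simp add: qq Rop_qq Nop_qq lin_ops_simps;
        rule poly_mapping_eqI; simp add: assms coeff_simps algebra_simps)
qed (simp add: ops_1 lin_ops_simps cscale_simps; simp add: algebra_simps)+

text \<open>Associativity of the product of the monomials with exponents \<open>d\<close>,
  \<open>c\<close>, \<open>a\<close>.\<close>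

lemma kap_add_left: "q powi (snd c * fst a) * kap d (c + a) = q powi (snd d * fst c) * kap (d + c) a"
  by (simp add: kap_def power_int_add algebra_simps)

text \<open>Trace property: the coefficient of \<open>1\<close> is invariant under cyclic rotation
  of the product with exponents \<open>d\<close>, \<open>a\<close>, \<open>c\<close>.\<close>

lemma kap_add_right: "q powi (snd a * fst c) * kap d (a + c) = q powi (snd c * fst d) * kap (d + c) a"
proof (cases "a + (d + c) = 0")
  case True
  have "a = a + (d + c) - (d + c)" by simp
  also have "\<dots> = - (d + c)" using True by simp
  finally have a: "fst a = - fst d - fst c" "snd a = - snd d - snd c" by simp_all
  have "snd a * fst c + snd d * (fst a + fst c) = snd c * fst d + (snd d + snd c) * fst a"
    unfolding a by (simp add: algebra_simps)
  then have "q powi (snd a * fst c) * q powi (snd d * (fst a + fst c)) =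
       q powi (snd c * fst d) * q powi ((snd d + snd c) * fst a)"
    by (metis power_int_add q_nz)
  then show ?thesis using True by (simp add: kap_def ac_simps)
qed (simp add: kap_def ac_simps)

lemma kap_weight:
  assumes "\<And>a b. h (a + b) = h a + h b"
  shows "of_int (h a) * kap c a = - (of_int (h c) * kap c a)"
proof (cases "a + c = 0")
  case True
  have "h 0 = 0" using assms[of 0 0] by simp
  then have "h a = - h c" using True assms[of a c] by simp
  then show ?thesis by simp
qed (simp add: kap_def)

lemma Nop_Dop:
  assumes "\<And>a b. h (a + b) = h a + h b"
  shows "Nop h (Dop s c u) = Dop s c (Nop h u) + of_int (h c) *\<^sub>c Dop s c u"
proof (induction u rule: qq_induct)
  case (qq r a u)
  have k: "of_int (h a) * (x * kap c a) = - (of_int (h c) * (x * kap c a))" for x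
    using kap_weight[of h, OF assms, of a c] by (metis mult.left_commute mult_minus_right)
  show ?case
    by (cases "r = s";
        simp add: qq Dop_qq Nop_qq lin_ops_simps Nop_Lop[of h, OF assms] Nop_Rop[of h, OF assms];
        rule poly_mapping_eqI; simp add: assms kap_weight[of h, OF assms] k coeff_simps algebra_simps)
qed (simp add: ops_1 lin_ops_simps cscale_simps; simp add: algebra_simps)+

text \<open>Matrices act on rows dually to their action on columns:
  \<open>[L_M, D_\<xi>] = - D_(\<xi> M)\<close>. The constants agree by
  \<open>kap_add_left\<close>.\<close>

lemma Lop_Dop: "Lop s' s c (Dop t d u) = Dop t d (Lop s' s c u)
    - (if t = s' then q powi (snd d * fst c) *\<^sub>c Dop s (d + c) u else 0)"
proof (induction u rule: qq_induct)
  case (qq r a u)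
  show ?case
    using qq
    by (cases s; cases s'; cases t; cases r)
      (simp_all add: Dop_qq Lop_qq Lop_Lop[of _ _ c _ _ "a + d"] Rop_Lop[symmetric] lin_ops_simps cscale_simps kap_add_left,
        (rule poly_mapping_eqI; simp add: coeff_simps algebra_simps)+)
qed (simp add: ops_1 lin_ops_simps cscale_simps; simp add: algebra_simps)+

text \<open>Dually to right multiplication of columns, a scalar \<open>z\<close> multiplies rows
  from the left: \<open>[R_z, D_\<xi>] = - D_(z \<xi>)\<close>. The constants agree by the trace
  property.\<close>

lemma Rop_Dop: "Rop c (Dop t d u) = Dop t d (Rop c u) - q powi (snd c * fst d) *\<^sub>c Dop t (d + c) u"
proof (induction u rule: qq_induct)
  case (qq r a u)
  show ?case
    by (cases "r = t")
      (simp_all add: qq Dop_qq Rop_qq Rop_Lop Rop_Rop[of c "d + a"] lin_ops_simps cscale_simps kap_add_right,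
        (rule poly_mapping_eqI; simp add: coeff_simps algebra_simps)+)
qed (simp add: ops_1 lin_ops_simps cscale_simps; simp add: algebra_simps)+

text \<open>The commutator of \<open>[D_\<xi>, D_\<eta>]\<close> with a column \<open>w\<close> is
  \<open>D_(\<xi> w \<eta>) + D_(\<eta> w \<xi>)\<close> minus the same with the rows exchanged,
  hence zero.\<close>

lemma Dop_Dop: "Dop s c (Dop t d u) = Dop t d (Dop s c u)"
proof (induction u rule: qq_induct)
  case (qq r a u)
  show ?case
    using qq
    by (cases s; cases t; cases r)
      (simp_all add: Dop_qq Lop_Dop Rop_Dop lin_ops_simps,
        (rule poly_mapping_eqI; simp add: coeff_simps algebra_simps)+)
qed (simp add: ops_1 lin_ops_simps cscale_simps; simp add: algebra_simps)+
section \<open>The contravariant form\<close>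

lemma Rep_Abs_pt: "Rep_kindex (Abs_kindex (pt i)) = pt i"
  using Abs_kindex_inverse[OF pt_in] .

definition ix :: "kindex \<Rightarrow> idx" where "ix k = inv pt (Rep_kindex k)"

lemma ix_pt: "ix (Abs_kindex (pt i)) = i"
proof -
  have "inj pt" by (simp add: inj_def pt_eq_iff)
  then show ?thesis by (simp add: ix_def Rep_Abs_pt)
qed

definition xx :: "kindex \<Rightarrow> V \<Rightarrow> V"
  where "xx k f = X (Rep_kindex k) $ 1 $ 1 *\<^sub>c (var k * f) - X (Rep_kindex k) $ 2 $ 1 *\<^sub>c partial k f"

lemma lin_xx: "lin (xx k)"
  by (rule linI) (simp_all add: xx_def lin_add[OF lin_partial] lin_scale[OF lin_partial]
    cscale_simps mult.commute[where 'a = complex] distrib_left cscale_mult_right)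

lemma partial_xx: "partial k (xx l f) = (if k = l then X (Rep_kindex k) $ 1 $ 1 *\<^sub>c f else 0) + xx l (partial k f)"
  by (simp add: xx_def lin_add[OF lin_partial] lin_diff[OF lin_partial] lin_scale[OF lin_partial] partial_var_mult
    cscale_simps partial_commute[of k l])

lemma xx_commute: "xx k (xx l f) = xx l (xx k f)"
proof (cases "k = l")
  case False
  then show ?thesis
    by (simp add: xx_def lin_diff[OF lin_partial] lin_scale[OF lin_partial] partial_var_mult right_diff_distrib
        cscale_mult_right cscale_simps partial_commute[of k l] mult.left_commute[of "var k" "var l"])
       (simp add: mult.commute algebra_simps)
qed simp

text \<open>
  \<open>Psi\<close> reads off the coordinates of a vector with respect to \<open>\<B>\<close>: since \<open>x_A = a Q_A - c (\<partial>/\<partial>x_A)\<close> and \<open>a d = 1\<close>,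
  evaluation at the operators \<open>xx\<close> undoes evaluation at the operators \<open>qq\<close>.
\<close>

definition Psi :: "V \<Rightarrow> V" where "Psi = ev xx"

lemma lin_Psi: "lin Psi" and Psi_1: "Psi 1 = 1" and Psi_var_mult: "Psi (var k * f) = xx k (Psi f)"
  by (simp_all add: Psi_def lin_ev ev_1 ev_var_mult xx_commute lin_xx)

text \<open>The commutator of \<open>partial k\<close> with \<open>xx k\<close> is \<open>a\<close>,
  so the derivative is rescaled by the inverse \<open>d\<close> of \<open>a\<close>.\<close>

lemma Psi_partial: "Psi (partial k f) = X (Rep_kindex k) $ 2 $ 2 *\<^sub>c partial k (Psi f)"
proof (induction f rule: V_induct)
  case (var l f)
  have "X (Rep_kindex k) $ 2 $ 2 * X (Rep_kindex k) $ 1 $ 1 = 1"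
    using kindex_pt[of k] by (metis Rep_Abs_pt X_diag(2))
  with var show ?case
    by (cases "k = l") (simp_all add: partial_var_mult lin_add[OF lin_Psi] Psi_var_mult lin_0[OF lin_Psi] partial_xx cscale_simps lin_scale[OF lin_xx])
qed (simp_all add: Psi_1 partial_1 lin_add[OF lin_Psi] lin_scale[OF lin_Psi] lin_0[OF lin_Psi]
      lin_add[OF lin_partial] lin_scale[OF lin_partial] cscale_simps mult.commute)

text \<open>In \<open>c d \<partial> + d (a x - c \<partial>)\<close> the derivatives cancel and
  \<open>a d = 1\<close> leaves \<open>x\<close>.\<close>

lemma Psi_qq: "Psi (qq i u) = var (Abs_kindex (pt i)) * Psi u"
  by (simp add: qq_def Q_def lin_add[OF lin_Psi] lin_scale[OF lin_Psi] Psi_partial Psi_var_mult xx_def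
    Rep_Abs_pt cscale_simps X_diag mult.commute[where 'a = complex])

fun Aop :: "idx \<Rightarrow> V \<Rightarrow> V"
  where "Aop (s, a) u = q powi (fst a * snd a) *\<^sub>c Dop s (- a) u"

lemma lin_Aop: "lin (Aop i)"
  by (cases i) (rule linI; simp add: lin_ops_simps cscale_simps mult.commute)

lemma Aop_commute: "Aop i (Aop j u) = Aop j (Aop i u)"
proof -
  obtain s a t b where "i = (s, a)" "j = (t, b)" by (metis surj_pair)
  then show ?thesis
    by (simp add: lin_ops_simps cscale_simps mult.commute Dop_Dop[of s "- a" t "- b"])
qed

lemma Aop_1: "Aop i 1 = 0"
  by (cases i) (simp add: ops_1 cscale_simps)

text \<open>The coordinate at \<open>1\<close> with respect to \<open>\<B>\<close>, as
  \<open>Psi\<close> turns that basis into the monomials.\<close>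

definition vac :: "V \<Rightarrow> complex" where "vac v = Poly_Mapping.lookup (Psi v) 0"

lemma vac_simps: "vac 1 = 1" "vac (u + v) = vac u + vac v" "vac (c *\<^sub>c u) = c * vac u" "vac 0 = 0"
  "vac (- u) = - vac u" "vac (u - v) = vac u - vac v"
  by (simp_all add: vac_def Psi_1 lin_add[OF lin_Psi] lin_scale[OF lin_Psi] lin_0[OF lin_Psi]
    lin_minus[OF lin_Psi] lin_diff[OF lin_Psi] lookup_add lookup_minus lookup_cscale)

lemma lookup_var_mult_0: "Poly_Mapping.lookup (var k * f) 0 = 0"
proof (induction f rule: poly_mapping_add_induct)
  case (1 \<alpha> c)
  have "Poly_Mapping.lookup (Poly_Mapping.single k (1::nat) + \<alpha>) k \<noteq> 0"
    by (simp add: lookup_add)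
  then have "Poly_Mapping.single k (1::nat) + \<alpha> \<noteq> 0" by (metis lookup_zero)
  then show ?case by (simp add: var_mult_single lookup_single when_def)
qed (simp add: distrib_left lookup_add)

lemma vac_qq: "vac (qq i u) = 0"
  by (simp add: vac_def Psi_qq lookup_var_mult_0)

text \<open>The adjoints are substituted for the variables of \<open>g\<close>; conjugating only the
  vacuum coefficient gives linearity in \<open>g\<close> and conjugate-linearity in
  \<open>v\<close>.\<close>

definition pairing :: "V \<Rightarrow> V \<Rightarrow> complex"
  where "pairing g v = (\<Sum>\<alpha>\<in>Poly_Mapping.keys g. Poly_Mapping.lookup g \<alpha> * cnj (vac (mon_op (\<lambda>k. Aop (ix k)) \<alpha> v)))"

lemma pairing_single: "pairing (Poly_Mapping.single \<alpha> c) v = c * cnj (vac (mon_op (\<lambda>k. Aop (ix k)) \<alpha> v))"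
  by (cases "c = 0") (simp_all add: pairing_def)

lemma pairing_add_left: "pairing (g + g') v = pairing g v + pairing g' v"
  unfolding pairing_def by (rule setsum_keys_plus_distrib) (simp_all add: algebra_simps)

lemma pairing_scale_left: "pairing (c *\<^sub>c g) v = c * pairing g v"
  by (induction g rule: poly_mapping_add_induct)
     (simp_all add: pairing_single cscale_simps pairing_add_left algebra_simps)

lemma pairing_right: "pairing g (v + v') = pairing g v + pairing g v'" "pairing g (c *\<^sub>c v) = cnj c * pairing g v"
proof -
  have *: "lin (mon_op (\<lambda>k. Aop (ix k)) \<alpha>)" for \<alpha>
    by (rule lin_mon_op) (simp_all add: Aop_commute lin_Aop)
  show "pairing g (v + v') = pairing g v + pairing g v'" "pairing g (c *\<^sub>c v) = cnj c * pairing g v"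
    by (simp_all add: pairing_def lin_add[OF *] lin_scale[OF *] vac_simps sum_distrib_left sum.distrib algebra_simps)
qed

lemma pairing_var_mult: "pairing (var k * g) v = pairing g (Aop (ix k) v)"
proof (induction g rule: poly_mapping_add_induct)
  case (1 \<alpha> c)
  show ?case
    by (simp add: pairing_single var_mult_single mon_op_add(2)[of "\<lambda>k. Aop (ix k)"] Aop_commute del: One_nat_def)
qed (simp add: pairing_add_left distrib_left)

definition F :: "V \<Rightarrow> V \<Rightarrow> complex" where "F u v = pairing (Psi u) v"

lemma F_add: "F (u + u') v = F u v + F u' v" "F u (v + v') = F u v + F u v'"
  and F_scale: "F (c *\<^sub>c u) v = c * F u v" "F u (c *\<^sub>c v) = cnj c * F u v"
  by (simp_all add: F_def lin_add[OF lin_Psi] lin_scale[OF lin_Psi] pairing_add_left pairing_scale_left pairing_right)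

lemma F_0: "F 0 v = 0" "F u 0 = 0"
  using F_scale(1)[of 0 0] F_scale(2)[of _ 0 0] by (simp_all add: cscale_simps)

lemma F_minus: "F (- u) v = - F u v" "F u (- v) = - F u v"
  using F_scale(1)[of "-1" u v] F_scale(2)[of u "-1" v] by (simp_all add: cscale_simps)

lemma F_diff: "F (u - u') v = F u v - F u' v" "F u (v - v') = F u v - F u v'"
  using F_add F_minus by (metis diff_conv_add_uminus)+

lemmas F_simps = F_add F_scale F_0 F_minus F_diff

lemma F_qq: "F (qq i u) v = F u (Aop i v)"
  by (simp add: F_def Psi_qq pairing_var_mult ix_pt)

lemma F_1: "F 1 v = cnj (vac v)"
proof -
  have "pairing (Poly_Mapping.single 0 1) v = cnj (vac v)"
    by (simp only: pairing_single mon_op_0 mult_1)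
  then show ?thesis by (simp add: F_def Psi_1)
qed

section \<open>Contravariance for multiplications and degree operators\<close>

lemma vac_ops: "vac (Lop s' s c v) = 0" "vac (Rop c v) = 0" "vac (Nop h v) = 0"
  by (induction v rule: qq_induct; auto simp: ops_1 Lop_qq Rop_qq Nop_qq lin_ops_simps vac_simps vac_qq)+

lemma cnj_q: "cnj (q powi k) = q powi (- k)"
  by (rule cnj_powi_unit[OF cmod_q])

text \<open>\<open>Lop_Dop\<close> for adjoints: the correction has the conjugate of the coefficient
  in \<open>Lop_qq\<close>.\<close>

lemma Lop_Aop: "q powi (fst c * snd c) *\<^sub>c Lop s s' (- c) (Aop (t, a) v)
  = Aop (t, a) (q powi (fst c * snd c) *\<^sub>c Lop s s' (- c) v)
    - (if t = s then q powi (- (snd c * fst a)) *\<^sub>c Aop (s', c + a) v else 0)"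
proof -
  have "q powi (fst c * snd c) * (q powi (fst a * snd a) * q powi (snd a * fst c))
      = q powi (- (snd c * fst a)) * q powi (fst (c + a) * snd (c + a))"
    unfolding power_int_add[OF disjI1[OF q_nz], symmetric] by (simp add: algebra_simps)
  then show ?thesis
    by (simp add: Lop_Dop lin_ops_simps cscale_simps mult.commute[where 'a = complex] mult.left_commute[where 'a = complex] add.commute)
qed

lemma Rop_Aop: "q powi (fst c * snd c) *\<^sub>c Rop (- c) (Aop (t, a) v)
  = Aop (t, a) (q powi (fst c * snd c) *\<^sub>c Rop (- c) v)
    - q powi (- (snd a * fst c)) *\<^sub>c Aop (t, a + c) v"
proof -
  have "q powi (fst c * snd c) * (q powi (fst a * snd a) * q powi (snd c * fst a))
      = q powi (- (snd a * fst c)) * q powi (fst (a + c) * snd (a + c))"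
    unfolding power_int_add[OF disjI1[OF q_nz], symmetric] by (simp add: algebra_simps)
  then show ?thesis
    by (simp add: Rop_Dop lin_ops_simps cscale_simps mult.commute[where 'a = complex] mult.left_commute[where 'a = complex])
qed

lemma Nop_Aop:
  assumes "\<And>a b. h (a + b) = h a + h b"
  shows "Nop h (Aop (t, a) v) = Aop (t, a) (Nop h v) - of_int (h a) *\<^sub>c Aop (t, a) v"
proof -
  have "h 0 = 0" using assms[of 0 0] by simp
  then have "h (- a) = - h a" using assms[of a "- a"] by simp
  then show ?thesis
    by (simp add: Nop_Dop[of h, OF assms] lin_ops_simps cscale_simps cscale_minus_left mult.commute)
qed

text \<open>Induction on the level: the front factor crosses over as its adjoint, and the
  corrections from \<open>Lop_qq\<close> and \<open>Lop_Aop\<close> cancel. At \<open>1\<close> both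
  sides vanish by \<open>vac_ops\<close>.\<close>

lemma F_Lop: "F (Lop s' s c u) v = F u (q powi (fst c * snd c) *\<^sub>c Lop s s' (- c) v)"
proof (induction u arbitrary: v rule: qq_induct)
  case one
  show ?case by (simp add: ops_1 F_0 F_1 vac_simps vac_ops)
next
  case (qq t a u)
  have "F (Lop s' s c (qq (t, a) u)) v = F u (q powi (fst c * snd c) *\<^sub>c Lop s s' (- c) (Aop (t, a) v))
      + (if t = s then q powi (snd c * fst a) * F u (Aop (s', c + a) v) else 0)"
    by (simp add: Lop_qq F_add F_scale(1) F_0 F_qq qq del: Aop.simps)
  also have "\<dots> = F u (Aop (t, a) (q powi (fst c * snd c) *\<^sub>c Lop s s' (- c) v))"
    unfolding Lop_Aop by (simp add: F_diff F_scale(2) F_0 cnj_q del: complex_cnj_power_int Aop.simps)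
  finally show ?case by (simp only: F_qq)
qed (simp_all add: lin_ops_simps F_simps distrib_left del: complex_cnj_power_int)

lemma F_Rop: "F (Rop c u) v = F u (q powi (fst c * snd c) *\<^sub>c Rop (- c) v)"
proof (induction u arbitrary: v rule: qq_induct)
  case one
  show ?case by (simp add: ops_1 F_0 F_1 vac_simps vac_ops)
next
  case (qq t a u)
  have "F (Rop c (qq (t, a) u)) v = F u (q powi (fst c * snd c) *\<^sub>c Rop (- c) (Aop (t, a) v))
      + q powi (snd a * fst c) * F u (Aop (t, a + c) v)"
    by (simp add: Rop_qq F_add F_scale(1) F_qq qq del: Aop.simps)
  also have "\<dots> = F u (Aop (t, a) (q powi (fst c * snd c) *\<^sub>c Rop (- c) v))"
    unfolding Rop_Aop by (simp add: F_diff F_scale(2) cnj_q del: complex_cnj_power_int Aop.simps)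
  finally show ?case by (simp only: F_qq)
qed (simp_all add: lin_ops_simps F_simps distrib_left del: complex_cnj_power_int)

lemma F_Nop:
  assumes "\<And>a b. h (a + b) = h a + h b"
  shows "F (Nop h u) v = F u (Nop h v)"
proof (induction u arbitrary: v rule: qq_induct)
  case one
  show ?case by (simp add: ops_1 F_0 F_1 vac_simps vac_ops)
next
  case (qq t a u)
  show ?case
    by (simp add: Nop_qq F_qq F_simps qq Nop_Aop[of h, OF assms] del: Aop.simps)
qed (simp_all add: lin_ops_simps F_simps)

section \<open>Hermitian symmetry\<close>

definition Cop :: "bool \<Rightarrow> int \<times> int \<Rightarrow> bool \<Rightarrow> int \<times> int \<Rightarrow> V \<Rightarrow> V"
  where "Cop s a t b u =
    (if s = t then (if a = b then \<mu> else 0) *\<^sub>c u + q powi (fst a * snd a - snd a * fst b) *\<^sub>c Rop (b - a) u else 0)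
    + q powi (fst a * snd a - snd b * fst a) *\<^sub>c Lop t s (b - a) u"

lemma Aop_qq: "Aop (s, a) (qq (t, b) u) = qq (t, b) (Aop (s, a) u) + Cop s a t b u"
proof -
  \<comment> \<open>At \<open>b = a\<close> the normalizing power of \<open>q\<close> is inverse to
    the one in \<open>kap\<close>, leaving the real number \<open>\<mu>\<close>.\<close>
  have 1: "q powi (fst a * snd a) * kap (- a) b = (if a = b then \<mu> else 0)"
    by (auto simp: kap_def power_int_add[OF disjI1[OF q_nz], symmetric] mult.commute mult.left_commute eq_neg_iff_add_eq_0[symmetric])
  have 2: "q powi (fst a * snd a) * q powi x = q powi (fst a * snd a + x)" for x
    by (simp add: power_int_add)
  show ?thesis
    by (simp add: Dop_qq Cop_def lin_ops_simps cscale_simps 1 2)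
qed

text \<open>\<open>Cop\<close> consists of left and right multiplications, with known adjoints, and
  a real constant.\<close>

lemma F_Cop: "F (Cop s a t b u) v = F u (Cop t b s a v)"
proof -
  have R: "q powi (fst a * snd a - snd a * fst b) * q powi (- (fst (b - a) * snd (b - a)))
      = q powi (- (fst b * snd b - snd b * fst a))"
    unfolding power_int_add[OF disjI1[OF q_nz], symmetric] by (simp add: algebra_simps)
  have L: "q powi (fst a * snd a - snd b * fst a) * q powi (- (fst (b - a) * snd (b - a)))
      = q powi (- (fst b * snd b - snd a * fst b))"
    unfolding power_int_add[OF disjI1[OF q_nz], symmetric] by (simp add: algebra_simps)
  show ?thesis
  \<comment> \<open>The constant occurs only for \<open>a = b\<close>, where all powers of
    \<open>q\<close> are \<open>1\<close>.\<close>
  proof (cases "a = b")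
    case True
    then show ?thesis
      using F_Lop[of t s 0 u v] F_Rop[of 0 u v]
      by (simp add: Cop_def F_add F_scale F_0 mult.commute zero_prod_def cscale_simps)
  next
    case False
    then show ?thesis
      by (cases "s = t")
        (simp_all only: Cop_def F_add F_scale F_Lop F_Rop if_True if_False cnj_q mult.assoc[symmetric] R L
          minus_diff_eq simp_thms complex_cnj_complex_of_real F_0 eq_commute)
  qed
qed

text \<open>Passing the front factor \<open>qq (t, b)\<close> leaves \<open>Cop\<close>, whose
  adjoint is exactly the commutator that arises when \<open>Aop (t, b)\<close> passes
  \<open>qq i\<close> on the other side.\<close>

lemma F_Aop: "F (Aop i u) v = F u (qq i v)"
proof (induction u arbitrary: v rule: qq_induct)
  case one
  show ?case by (simp add: Aop_1 F_0 F_1 vac_qq)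
next
  case (qq t b u)
  obtain s a where i: "i = (s, a)" by (metis surj_pair)
  have "F (Aop i (qq (t, b) u)) v = F u (qq i (Aop (t, b) v)) + F u (Cop t b s a v)"
    by (simp add: i Aop_qq F_add F_qq F_Cop qq[unfolded i] del: Aop.simps)
  also have "\<dots> = F (qq (t, b) u) (qq i v)"
    by (simp add: i F_qq Aop_qq F_add del: Aop.simps)
  finally show ?case .
qed (simp_all add: lin_add[OF lin_Aop] lin_scale[OF lin_Aop] F_simps)

text \<open>\<open>F_qq\<close> and \<open>F_Aop\<close> take a factor off either argument, until
  only \<open>vac\<close> remains.\<close>

lemma F_hermitian: "F v u = cnj (F u v)"
proof (induction u arbitrary: v rule: qq_induct)
  case one
  show ?case
    by (induction v rule: qq_induct) (simp_all add: F_1 vac_simps F_simps F_qq Aop_1 vac_qq)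
next
  case (qq t b u)
  then show ?case by (simp add: F_qq F_Aop[symmetric])
qed (simp_all add: F_simps)

end

section \<open>The operators of the representation\<close>

lemma sum'_image:
  assumes "inj_on f I" "finite T" "\<And>i. i \<in> I \<Longrightarrow> g (f i) \<noteq> 0 \<Longrightarrow> i \<in> T"
  shows "sum' g (f ` I) = (\<Sum>i\<in>T. if i \<in> I then g (f i) else 0)"
proof -
  have sub: "{x \<in> f ` I. g x \<noteq> 0} \<subseteq> f ` (T \<inter> I)"
    using assms(3) by auto
  have fin: "finite (f ` (T \<inter> I))" using assms(2) by simp
  have "sum' g (f ` I) = sum g {x \<in> f ` I. g x \<noteq> 0}"
    using sub fin by (simp add: sum.G_def finite_subset)
  also have "\<dots> = sum g (f ` (T \<inter> I))"
    using sub fin by (intro sum.mono_neutral_left) auto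
  also have "\<dots> = (\<Sum>i\<in>T \<inter> I. g (f i))"
    using assms(1) by (subst sum.reindex) (auto intro: inj_on_subset)
  also have "\<dots> = (\<Sum>i\<in>T. if i \<in> I then g (f i) else 0)"
    using assms(2) by (simp add: sum.inter_restrict)
  finally show ?thesis .
qed

lemma sum_if_split:
  fixes h :: "'a \<Rightarrow> 'b \<Rightarrow> 'c::comm_monoid_add"
  shows "(\<Sum>i\<in>S. \<Sum>j\<in>T. if R i then h i j else 0) =
    (\<Sum>i\<in>S. \<Sum>j\<in>T. if R i \<and> R' j then h i j else 0) + (\<Sum>i\<in>S. \<Sum>j\<in>T. if R i \<and> \<not> R' j then h i j else 0)"
  unfolding sum.distrib[symmetric] by (intro sum.cong) auto

lemma image_pt: "pt ` {i. fst i} = K1" "pt ` {i. \<not> fst i} = Km1"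
proof -
  have *: "(3 * m + 1, 3 * n + 1) = pt (True, m, n)" "(3 * m - 1, 3 * n - 1) = pt (False, m, n)" for m n
    by (simp_all add: pt.simps)
  show "pt ` {i. fst i} = K1" "pt ` {i. \<not> fst i} = Km1"
    unfolding K1_def Km1_def * by force+
qed

lemma inj_pt: "inj_on pt I"
  by (simp add: inj_on_def pt_eq_iff)

lemma sum'_K:
  assumes "finite S" "\<And>i. g (pt i) \<noteq> 0 \<Longrightarrow> i \<in> S"
  shows "sum' g K1 = (\<Sum>i\<in>S. if fst i then g (pt i) else 0)"
    and "sum' g Km1 = (\<Sum>i\<in>S. if \<not> fst i then g (pt i) else 0)"
  unfolding image_pt[symmetric] using assms by (simp_all add: sum'_image[OF inj_pt, of S])

lemma sum'_K_Times:
  assumes "finite S" "\<And>i j. g (pt i, pt j) \<noteq> 0 \<Longrightarrow> i \<in> S \<and> j \<in> S"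
  shows "sum' g (pt ` I \<times> pt ` J) = (\<Sum>i\<in>S. \<Sum>j\<in>S. if i \<in> I \<and> j \<in> J then g (pt i, pt j) else 0)"
proof -
  have "pt ` I \<times> pt ` J = map_prod pt pt ` (I \<times> J)" by (simp add: map_prod_image)
  moreover have "sum' g (map_prod pt pt ` (I \<times> J)) =
      (\<Sum>p\<in>S \<times> S. if p \<in> I \<times> J then g (map_prod pt pt p) else 0)"
    using assms by (intro sum'_image) (auto simp: inj_on_def pt_eq_iff)
  ultimately show ?thesis
    by (simp add: sum.cartesian_product case_prod_beta mem_Times_iff map_prod_def cong: if_cong)
qed

lemma fst3_snd3_pt: "(pt (s, a))\<^bold>1 = fst a" "(pt (s, a))\<^bold>2 = snd a"
  by (cases s; cases a; simp add: pt.simps fst3_snd3)+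

text \<open>The offsets match the residues modulo 3, so only exponents add and the class of the
  result is the expected one.\<close>

lemma pt_add:
  "(3 * m, 3 * n) + pt (s, a) = pt (s, (m, n) + a)"
  "(3 * m + 2, 3 * n + 2) + pt (False, a) = pt (True, (m, n) + a)"
  "(3 * m - 2, 3 * n - 2) + pt (True, a) = pt (False, (m, n) + a)"
  "pt (True, a) + pt (s, b) + (3 * m - 1, 3 * n - 1) = pt (s, b + ((m, n) + a))"
  "pt (s, a) + pt (False, b) + (3 * m + 1, 3 * n + 1) = pt (s, a + ((m, n) + b))"
  "pt (s, a) + pt (True, b) + (3 * m - 1, 3 * n - 1) = pt (s, a + ((m, n) + b))"
  by (cases a; cases b; cases s; simp add: pt.simps)+

context fock
begin

lemma P_Q_pt: "P X (pt i) = pp i" "Q X (pt i) = qq i"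
  by (simp_all add: pp_def qq_def)

lemma pp_0: "pp i 0 = 0"
  by (rule lin_0[OF lin_pp])

lemma e12_eq: "e12 X m n f = qq (True, m, n) f" and e32_eq: "e32 X m n f = qq (False, m, n) f"
  by (simp_all add: e12_def e32_def qq_def pt.simps)

lemma Q_0: "Q X A 0 = 0"
  by (simp add: Q_def lin_0[OF lin_partial] cscale_simps)

lemma sum'_pp:
  assumes "\<And>i. pp i f = 0 \<Longrightarrow> g (pt i) = 0"
  shows "sum' g K1 = (\<Sum>i | pp i f \<noteq> 0. if fst i then g (pt i) else 0)"
    and "sum' g Km1 = (\<Sum>i | pp i f \<noteq> 0. if \<not> fst i then g (pt i) else 0)"
  using assms by (auto intro!: sum'_K finite_pp)

text \<open>Derivatives commute, so a nonzero second derivative forces both first derivatives to be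
  nonzero.\<close>

lemma sum'_pp_Times:
  assumes "\<And>i j. pp i (pp j f) = 0 \<Longrightarrow> g (pt i, pt j) = 0"
  shows "sum' g (pt ` I \<times> pt ` J) =
    (\<Sum>i | pp i f \<noteq> 0. \<Sum>j | pp j f \<noteq> 0. if i \<in> I \<and> j \<in> J then g (pt i, pt j) else 0)"
proof (rule sum'_K_Times[OF finite_pp])
  fix i j assume "g (pt i, pt j) \<noteq> 0"
  then have "pp i (pp j f) \<noteq> 0" using assms by blast
  then show "i \<in> {i. pp i f \<noteq> 0} \<and> j \<in> {i. pp i f \<noteq> 0}"
    using pp_commute[of i j f] pp_0[of i] pp_0[of j] by auto
qed

lemma sum'_Lop:
  assumes "\<And>a. A + pt (s, a) = pt (s', (m, n) + a)"
  shows "sum' (\<lambda>B. q powi (B\<^bold>1 * n) *\<^sub>c Q X (A + B) (P X B f)) (if s then K1 else Km1) = Lop s' s (m, n) f"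
  unfolding Lop_def Der_def using assms
  by (cases s) (auto simp: sum'_pp[of f] P_Q_pt Q_0 cscale_simps fst3_snd3_pt mult.commute[of _ n] intro!: sum.cong)

lemma e11_eq: "e11 q \<mu> X m n f = Lop True True (m, n) f + (if (m, n) = (0, 0) then 1 / 2 * \<mu> else 0) *\<^sub>c f"
  using sum'_Lop[of "(3 * m, 3 * n)" True True m n f] by (simp add: e11_def pt_add cscale_simps)

lemma e33_eq: "e33 q \<mu> X m n f = Lop False False (m, n) f + (if (m, n) = (0, 0) then 1 / 2 * \<mu> else 0) *\<^sub>c f"
  using sum'_Lop[of "(3 * m, 3 * n)" False False m n f] by (simp add: e33_def pt_add cscale_simps)

lemma e13_eq: "e13 q X m n f = Lop True False (m, n) f"
  using sum'_Lop[of "(3 * m + 2, 3 * n + 2)" False True m n f] by (simp add: e13_def pt_add)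

lemma e31_eq: "e31 q X m n f = Lop False True (m, n) f"
  using sum'_Lop[of "(3 * m - 2, 3 * n - 2)" True False m n f] by (simp add: e31_def pt_add)

lemma e22_eq: "e22 q \<mu> X m n f = - Rop (m, n) f - (if (m, n) = (0, 0) then 1 / 2 * \<mu> else 0) *\<^sub>c f"
proof -
  have "sum' (\<lambda>A. q powi (A\<^bold>2 * m) *\<^sub>c Q X ((3*m, 3*n) + A) (P X A f)) K1
      + sum' (\<lambda>B. q powi (B\<^bold>2 * m) *\<^sub>c Q X ((3*m, 3*n) + B) (P X B f)) Km1 = Rop (m, n) f"
    unfolding Rop_def Der_def
    by (simp add: sum'_pp[of f] P_Q_pt Q_0 cscale_simps fst3_snd3_pt sum.distrib[symmetric])
      (auto simp: pt_add fst3_snd3_pt P_Q_pt add.commute[of m] add.commute[of n] intro!: sum.cong)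
  then show ?thesis
    by (auto simp: e22_def cscale_simps algebra_simps)
qed

lemma D1_eq: "D1 X f = Nop fst f" and D2_eq: "D2 X f = Nop snd f"
  unfolding D1_def D2_def Nop_def Der_def
  by (simp_all add: sum'_pp[of f] P_Q_pt cscale_simps lin_0[OF lin_qq] sum.distrib[symmetric])
    (auto simp: fst3_snd3_pt P_Q_pt intro!: sum.cong)

lemma Dop_expand:
  "Dop s (m, n) f = (q powi (- (m * n)) * \<mu>) *\<^sub>c pp (s, - m, - n) f
    + (\<Sum>i | pp i f \<noteq> 0. \<Sum>j | pp j f \<noteq> 0. if fst i = s then
        q powi (n * fst (snd i) + snd (snd j) * m + snd (snd j) * fst (snd i)) *\<^sub>c
          qq (fst j, snd j + ((m, n) + snd i)) (pp j (pp i f)) else 0)"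
proof -
  let ?S = "{i. pp i f \<noteq> 0}"
  have R: "Rop c (pp i f) = (\<Sum>j\<in>?S. q powi (snd (snd j) * fst c) *\<^sub>c qq (fst j, snd j + c) (pp j (pp i f)))" for c i
  proof -
    have "{j. pp j (pp i f) \<noteq> 0} \<subseteq> ?S" by (auto simp: pp_commute[of _ i] pp_0)
    then show ?thesis unfolding Rop_def
      by (subst Der_superset[of _ ?S]) (auto simp: finite_pp intro!: lin_qq sum.cong)
  qed
  have "Dop s (m, n) f = (\<Sum>i\<in>?S. (if fst i = s then kap (m, n) (snd i) *\<^sub>c pp i f else 0)
      + (if fst i = s then q powi (n * fst (snd i)) *\<^sub>c Rop ((m, n) + snd i) (pp i f) else 0))"
    unfolding Dop_def Der_def by (auto intro!: sum.cong)
  also have "\<dots> = (\<Sum>i\<in>?S. if fst i = s then kap (m, n) (snd i) *\<^sub>c pp i f else 0) +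
     (\<Sum>i\<in>?S. \<Sum>j\<in>?S. if fst i = s then
        q powi (n * fst (snd i) + snd (snd j) * m + snd (snd j) * fst (snd i)) *\<^sub>c
          qq (fst j, snd j + ((m, n) + snd i)) (pp j (pp i f)) else 0)"
    unfolding sum.distrib R
    by (auto intro!: arg_cong2[of _ _ _ _ "(+)"] sum.cong simp: cscale_sum cscale_simps power_int_add distrib_left mult.assoc)
  also have "(\<Sum>i\<in>?S. if fst i = s then kap (m, n) (snd i) *\<^sub>c pp i f else 0)
     = (\<Sum>i\<in>?S. if i = (s, - m, - n) then (q powi (- (m * n)) * \<mu>) *\<^sub>c pp (s, - m, - n) f else 0)"
    by (intro sum.cong) (auto simp: kap_def cscale_simps mult.commute zero_prod_def eq_neg_iff_add_eq_0)
  \<comment> \<open>If the index \<open>(s, - m, - n)\<close> lies outside \<open>?S\<close>, its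
    derivative is zero and both sides vanish.\<close>
  also have "\<dots> = (q powi (- (m * n)) * \<mu>) *\<^sub>c pp (s, - m, - n) f"
    by (auto simp: finite_pp cscale_simps)
  finally show ?thesis .
qed

text \<open>Splitting the inner index of \<open>Dop_expand\<close> by its class gives the two double
  sums; in the first one \<open>A'\<close> is the outer index, whence the exchange of
  summations.\<close>

lemma e21_eq: "e21 q \<mu> X m n f = - Dop True (m, n) f"
proof -
  let ?S = "{i. pp i f \<noteq> 0}"
  have P: "- (3 * m - 1, 3 * n - 1) = pt (True, - m, - n)" by (simp add: pt.simps)
  have 1: "sum' (\<lambda>(A, A'). q powi (n * A'\<^bold>1 + A\<^bold>2 * m + A\<^bold>2 * A'\<^bold>1) *\<^sub>c
              Q X (A + A' + (3*m - 1, 3*n - 1)) (P X A (P X A' f))) (K1 \<times> K1)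
     = (\<Sum>i\<in>?S. \<Sum>j\<in>?S. if fst i \<and> fst j then
        q powi (n * fst (snd i) + snd (snd j) * m + snd (snd j) * fst (snd i)) *\<^sub>c
          qq (fst j, snd j + ((m, n) + snd i)) (pp j (pp i f)) else 0)"
    unfolding image_pt(1)[symmetric]
    by (subst sum'_pp_Times[of f]; (subst sum.swap)?; auto simp: P_Q_pt Q_0 cscale_simps fst3_snd3_pt pt_add(6) intro!: sum.cong)
  have 2: "sum' (\<lambda>(A, B). q powi (n * A\<^bold>1 + B\<^bold>2 * m + B\<^bold>2 * A\<^bold>1) *\<^sub>c
              Q X (A + B + (3*m - 1, 3*n - 1)) (P X A (P X B f))) (K1 \<times> Km1)
     = (\<Sum>i\<in>?S. \<Sum>j\<in>?S. if fst i \<and> \<not> fst j then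
        q powi (n * fst (snd i) + snd (snd j) * m + snd (snd j) * fst (snd i)) *\<^sub>c
          qq (fst j, snd j + ((m, n) + snd i)) (pp j (pp i f)) else 0)"
    unfolding image_pt[symmetric]
    by (subst sum'_pp_Times[of f]; auto simp: P_Q_pt Q_0 cscale_simps fst3_snd3_pt pt_add pp_commute intro!: sum.cong)
  show ?thesis
    unfolding e21_def 1 2 Dop_expand P P_Q_pt sum_if_split[where R = "\<lambda>i. fst i = True" and R' = fst] by simp
qed

lemma e23_eq: "e23 q \<mu> X m n f = - Dop False (m, n) f"
proof -
  let ?S = "{i. pp i f \<noteq> 0}"
  have P: "- (3 * m + 1, 3 * n + 1) = pt (False, - m, - n)" by (simp add: pt.simps)
  have 1: "sum' (\<lambda>(A, B). q powi (n * B\<^bold>1 + A\<^bold>2 * m + A\<^bold>2 * B\<^bold>1) *\<^sub>c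
              Q X (A + B + (3*m + 1, 3*n + 1)) (P X A (P X B f))) (K1 \<times> Km1)
     = (\<Sum>i\<in>?S. \<Sum>j\<in>?S. if \<not> fst i \<and> fst j then
        q powi (n * fst (snd i) + snd (snd j) * m + snd (snd j) * fst (snd i)) *\<^sub>c
          qq (fst j, snd j + ((m, n) + snd i)) (pp j (pp i f)) else 0)"
    unfolding image_pt[symmetric]
    by (subst sum'_pp_Times[of f]; (subst sum.swap)?; auto simp: P_Q_pt Q_0 cscale_simps fst3_snd3_pt pt_add intro!: sum.cong)
  have 2: "sum' (\<lambda>(B, B'). q powi (n * B'\<^bold>1 + B\<^bold>2 * m + B\<^bold>2 * B'\<^bold>1) *\<^sub>c
              Q X (B + B' + (3*m + 1, 3*n + 1)) (P X B (P X B' f))) (Km1 \<times> Km1)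
     = (\<Sum>i\<in>?S. \<Sum>j\<in>?S. if \<not> fst i \<and> \<not> fst j then
        q powi (n * fst (snd i) + snd (snd j) * m + snd (snd j) * fst (snd i)) *\<^sub>c
          qq (fst j, snd j + ((m, n) + snd i)) (pp j (pp i f)) else 0)"
    unfolding image_pt(2)[symmetric]
    by (subst sum'_pp_Times[of f]; (subst sum.swap)?; auto simp: P_Q_pt Q_0 cscale_simps fst3_snd3_pt pt_add intro!: sum.cong)
  show ?thesis
    unfolding e23_def 1 2 Dop_expand P P_Q_pt sum_if_split[where R = "\<lambda>i. fst i = False" and R' = fst] by simp
qed

section \<open>Contravariance and uniqueness\<close>

definition half :: "int \<Rightarrow> int \<Rightarrow> complex"
  where "half m n = (if (m, n) = (0, 0) then 1 / 2 * \<mu> else 0)"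

lemma e_simps:
  "e q \<mu> X 1 1 m n f = Lop True True (m, n) f + half m n *\<^sub>c f"
  "e q \<mu> X 1 2 m n f = qq (True, m, n) f"
  "e q \<mu> X 1 3 m n f = Lop True False (m, n) f"
  "e q \<mu> X 2 1 m n f = - Dop True (m, n) f"
  "e q \<mu> X 2 2 m n f = - Rop (m, n) f - half m n *\<^sub>c f"
  "e q \<mu> X 2 3 m n f = - Dop False (m, n) f"
  "e q \<mu> X 3 1 m n f = Lop False True (m, n) f"
  "e q \<mu> X 3 2 m n f = qq (False, m, n) f"
  "e q \<mu> X 3 3 m n f = Lop False False (m, n) f + half m n *\<^sub>c f"
  by (simp_all only: e_def vector_3 e11_eq e12_eq e13_eq e21_eq e22_eq e23_eq e31_eq e32_eq e33_eq half_def)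

lemma lin_e: "lin (e q \<mu> X i j m n)"
  using exhaust_3[of i] exhaust_3[of j]
  by (elim disjE; hypsubst; unfold e_simps[abs_def] diff_conv_add_uminus; intro lin_plus lin_uminus lin_cscale lin_id lin_ops)

text \<open>Only \<open>m = n = 0\<close> contributes, where the power of \<open>q\<close> is
  \<open>1\<close> and the value is real.\<close>

lemma half_adjoint: "cnj (q powi (m * n) * half (- m) (- n)) = half m n"
  by (simp add: half_def)

lemma msign_simps:
  "msign 1 1 = 1" "msign 1 2 = - 1" "msign 1 3 = 1" "msign 2 1 = - 1" "msign 2 2 = 1" "msign 2 3 = - 1"
  "msign 3 1 = 1" "msign 3 2 = - 1" "msign 3 3 = 1"
  unfolding msign_def by simp_all

lemma msign_commute: "msign i j = msign j i"
  by (auto simp: msign_def)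

lemma F_e: "F (e q \<mu> X i j m n u) v = F u ((msign i j * q powi (m * n)) *\<^sub>c e q \<mu> X j i (- m) (- n) v)"
proof -
  have D: "F (Dop s (m, n) u) v = cnj (q powi (m * n)) * F u (qq (s, - m, - n) v)" for s
  proof -
    have "Dop s (m, n) u = q powi (- (m * n)) *\<^sub>c Aop (s, - m, - n) u"
      by (simp add: cscale_simps power_int_add[OF disjI1[OF q_nz], symmetric])
    then show ?thesis by (simp add: F_scale F_Aop cnj_q del: Aop.simps complex_cnj_power_int)
  qed
  have q: "F (qq (s, m, n) u) v = cnj (q powi (m * n)) * F u (Dop s (- m, - n) v)" for s
    by (simp add: F_qq F_scale)
  show ?thesis
    using exhaust_3[of i] exhaust_3[of j]
    by (elim disjE; hypsubst;
        simp add: e_simps msign_simps F_simps F_Lop F_Rop D q cscale_simps half_adjoint distrib_left right_diff_distrib mult.assoc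
          del: complex_cnj_power_int complex_cnj_mult)
qed

lemma F_sum: "F (\<Sum>i\<in>S. f i) v = (\<Sum>i\<in>S. F (f i) v)" "F u (\<Sum>i\<in>S. f i) = (\<Sum>i\<in>S. F u (f i))"
  by (induction S rule: infinite_finite_induct; simp add: F_simps)+

definition act :: "3 \<Rightarrow> 3 \<Rightarrow> qtorus \<Rightarrow> V \<Rightarrow> V"
  where "act i j a u = (\<Sum>x\<in>Poly_Mapping.keys a. Poly_Mapping.lookup a x *\<^sub>c e q \<mu> X i j (fst x) (snd x) u)"

lemma act_single: "act i j (Poly_Mapping.single x c) u = c *\<^sub>c e q \<mu> X i j (fst x) (snd x) u"
  by (cases "c = 0") (simp_all add: act_def cscale_simps)

lemma act_add: "act i j (a + b) u = act i j a u + act i j b u"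
  unfolding act_def by (rule setsum_keys_plus_distrib) (simp_all add: cscale_simps cscale_add_left)

lemma F_act: "F (act i j a u) v = F u (act j i (msign i j *\<^sub>c qbar q a) v)"
proof (induction a rule: poly_mapping_add_induct)
  case (1 x c)
  show ?case
    by (simp add: act_single qbar_single cscale_simps F_scale F_e mult_ac)
qed (simp add: act_add qbar_add cscale_simps F_add)

lemma rep_act: "rep q \<mu> X (M, \<gamma>s, \<gamma>t, \<eta>s, \<eta>t) u =
    (\<Sum>i\<in>UNIV. \<Sum>j\<in>UNIV. act i j (M $ i $ j) u) + \<eta>s *\<^sub>c Nop fst u + \<eta>t *\<^sub>c Nop snd u"
  by (simp add: act_def D1_eq D2_eq)

lemma lin_rep: "lin (rep q \<mu> X x)"
proof (cases x)
  case (fields M \<gamma>s \<gamma>t \<eta>s \<eta>t)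
  have "rep q \<mu> X x = (\<lambda>u. (\<Sum>i\<in>UNIV. \<Sum>j\<in>UNIV. act i j (M $ i $ j) u) + \<eta>s *\<^sub>c Nop fst u + \<eta>t *\<^sub>c Nop snd u)"
    unfolding fields by (rule ext) (rule rep_act)
  then show ?thesis
    by (simp only: act_def) (intro lin_plus lin_setsum lin_cscale lin_e lin_Nop)
qed

lemma contravariant_F: "F (rep q \<mu> X x u) v = F u (rep q \<mu> X (\<omega> q x) v)"
proof (cases x)
  case (fields M \<gamma>s \<gamma>t \<eta>s \<eta>t)
  have "(\<Sum>i\<in>UNIV. \<Sum>j\<in>UNIV. F (act i j (M $ i $ j) u) v)
      = (\<Sum>i\<in>UNIV. \<Sum>j\<in>UNIV. F u (act j i (msign j i *\<^sub>c qbar q (M $ i $ j)) v))"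
    by (simp only: F_act msign_commute)
  \<comment> \<open>\<open>\<omega>\<close> transposes the matrix.\<close>
  also have "\<dots> = (\<Sum>j\<in>UNIV. \<Sum>i\<in>UNIV. F u (act j i (msign j i *\<^sub>c qbar q (M $ i $ j)) v))"
    by (rule sum.swap)
  finally show ?thesis
    unfolding fields \<omega>.simps rep_act by (simp add: F_simps F_sum F_Nop)
qed

lemma sesquilinear_F: "sesquilinear F"
  by (simp add: sesquilinear_def F_add F_scale)

section \<open>The basis \<open>\<B>\<close> and uniqueness of the form\<close>

lemma rep_E12: "rep q \<mu> X (E 1 2 (qmon m n)) u = qq (True, m, n) u"
  and rep_E32: "rep q \<mu> X (E 3 2 (qmon m n)) u = qq (False, m, n) u"
  by (simp_all add: rep_simps e_simps)

lemma basis_vector_Nil: "basis_vector q \<mu> X [] [] = 1"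
  by (simp add: basis_vector_def)

lemma basis_vector_Cons_left:
  "basis_vector q \<mu> X ((m, n) # \<alpha>s) \<beta>s = qq (True, m, n) (basis_vector q \<mu> X \<alpha>s \<beta>s)"
  by (simp add: basis_vector_def rep_E12)

lemma basis_vector_Cons_right:
  "basis_vector q \<mu> X \<alpha>s ((m, n) # \<beta>s) = qq (False, m, n) (basis_vector q \<mu> X \<alpha>s \<beta>s)"
proof (induction \<alpha>s)
  case Nil
  show ?case by (simp add: basis_vector_def rep_E32)
next
  case (Cons p \<alpha>s)
  then show ?case
    by (cases p) (simp add: basis_vector_Cons_left qq_commute[of "(False, m, n)"])
qed

lemma \<B>_iff: "f \<in> \<B> q \<mu> X \<longleftrightarrow> (\<exists>\<alpha>s \<beta>s. f = basis_vector q \<mu> X \<alpha>s \<beta>s)"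
  by (auto simp: \<B>_def has_level_def)

lemma basis_vector_induct [consumes 1, case_names one qq]:
  assumes "f \<in> \<B> q \<mu> X" "R 1" "\<And>s a u. u \<in> \<B> q \<mu> X \<Longrightarrow> R u \<Longrightarrow> R (qq (s, a) u)"
  shows "R f"
proof -
  have in\<B>: "basis_vector q \<mu> X \<alpha>s \<beta>s \<in> \<B> q \<mu> X" for \<alpha>s \<beta>s
    by (auto simp: \<B>_iff)
  have "R (basis_vector q \<mu> X \<alpha>s \<beta>s)" for \<alpha>s \<beta>s
  proof (induction \<alpha>s)
    case Nil
    show ?case
    proof (induction \<beta>s)
      case (Cons p \<beta>s)
      then show ?case
        by (cases p) (simp add: basis_vector_Cons_right assms(3)[OF in\<B>])
    qed (simp add: basis_vector_Nil assms(2))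
  next
    case (Cons p \<alpha>s)
    then show ?case
      by (cases p) (simp add: basis_vector_Cons_left assms(3)[OF in\<B>])
  qed
  with assms(1) show ?thesis by (auto simp: \<B>_iff)
qed

lemma one_in_\<B>: "1 \<in> \<B> q \<mu> X"
  using basis_vector_Nil \<B>_iff by metis

lemma qq_in_\<B>: "u \<in> \<B> q \<mu> X \<Longrightarrow> qq (s, a) u \<in> \<B> q \<mu> X"
proof -
  assume "u \<in> \<B> q \<mu> X"
  then obtain \<alpha>s \<beta>s where u: "u = basis_vector q \<mu> X \<alpha>s \<beta>s" by (auto simp: \<B>_iff)
  obtain m n where a: "a = (m, n)" by (cases a)
  show ?thesis
    unfolding u a \<B>_iff by (cases s) (metis basis_vector_Cons_left basis_vector_Cons_right)+
qed

text \<open>Outside level zero there is a front factor, on which \<open>vac\<close>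
  vanishes.\<close>

lemma has_level_cases:
  assumes "has_level q \<mu> X f k l"
  obtains "f = 1" "k = 0" "l = 0" | s a u where "f = qq (s, a) u" "(k, l) \<noteq> (0, 0)"
proof -
  obtain \<alpha>s \<beta>s where *: "length \<alpha>s = k" "length \<beta>s = l" "f = basis_vector q \<mu> X \<alpha>s \<beta>s"
    using assms by (auto simp: has_level_def)
  show thesis
  proof (cases \<alpha>s)
    case (Cons p \<alpha>s')
    then show thesis using that(2) * by (cases p) (auto simp: basis_vector_Cons_left)
  next
    case Nil
    show thesis
    proof (cases \<beta>s)
      case (Cons p \<beta>s')
      then show thesis using that(2) * by (cases p) (auto simp: basis_vector_Cons_right)
    qed (use that(1) * Nil in \<open>simp add: basis_vector_Nil\<close>)
  qed
qed

inductive bspan :: "V \<Rightarrow> bool"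
  where basis: "u \<in> \<B> q \<mu> X \<Longrightarrow> bspan u"
  | add: "bspan u \<Longrightarrow> bspan v \<Longrightarrow> bspan (u + v)"
  | scale: "bspan u \<Longrightarrow> bspan (c *\<^sub>c u)"

lemma bspan_UNIV: "bspan f"
proof (induction f rule: qq_induct)
  case (qq r a u)
  then show ?case
    by (induction rule: bspan.induct) (auto intro: bspan.intros qq_in_\<B> simp: lin_add[OF lin_qq] lin_scale[OF lin_qq])
qed (auto intro: bspan.intros one_in_\<B>)

lemma sesquilinear_eqI:
  assumes "sesquilinear G" "sesquilinear H"
    and "\<And>u v. u \<in> \<B> q \<mu> X \<Longrightarrow> v \<in> \<B> q \<mu> X \<Longrightarrow> G u v = H u v"
  shows "G u v = H u v"
proof -
  have "G u v = H u v" if "u \<in> \<B> q \<mu> X" for u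
    using bspan_UNIV[of v] by induction (use assms that in \<open>simp_all add: sesquilinear_def\<close>)
  with bspan_UNIV[of u] show ?thesis
    by induction (use assms in \<open>simp_all add: sesquilinear_def\<close>)
qed

lemma level_recursive_F: "level_recursive q \<mu> X F"
proof -
  have "F 1 f = 0" if "has_level q \<mu> X f k l" "(k, l) \<noteq> (0, 0)" for f k l
    using that(1) by (cases rule: has_level_cases) (use that(2) in \<open>auto simp: F_1 vac_qq\<close>)
  then show ?thesis
    by (auto simp: level_recursive_def sesquilinear_F F_1 vac_simps contravariant_F simp del: \<omega>.simps rep.simps)
qed

lemma level_recursive_unique:
  assumes "level_recursive q \<mu> X G"
  shows "G = F"
proof -
  have G: "sesquilinear G" "G 1 1 = 1" "\<And>f k l. has_level q \<mu> X f k l \<Longrightarrow> (k, l) \<noteq> (0, 0) \<Longrightarrow> G 1 f = 0"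
    and G12: "\<And>u v m n. u \<in> \<B> q \<mu> X \<Longrightarrow> v \<in> \<B> q \<mu> X \<Longrightarrow>
      G (rep q \<mu> X (E 1 2 (qmon m n)) u) v = G u (rep q \<mu> X (\<omega> q (E 1 2 (qmon m n))) v)"
    and G32: "\<And>u v m n. u \<in> \<B> q \<mu> X \<Longrightarrow> v \<in> \<B> q \<mu> X \<Longrightarrow>
      G (rep q \<mu> X (E 3 2 (qmon m n)) u) v = G u (rep q \<mu> X (\<omega> q (E 3 2 (qmon m n))) v)"
    using assms unfolding level_recursive_def by blast+
  define y where "y s a = (if s then E 1 2 (qmon (fst a) (snd a)) else E 3 2 (qmon (fst a) (snd a)))"
    for s :: bool and a :: "int \<times> int"
  have y: "rep q \<mu> X (y s a) u = qq (s, a) u" for s a u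
    by (simp add: y_def rep_E12 rep_E32)
  \<comment> \<open>The recursion is given for \<open>v\<close> in \<open>\<B>\<close>, but the
    adjoint may lead out of \<open>\<B>\<close>; conjugate-linearity extends it to all
    \<open>v\<close>.\<close>
  have step: "G (qq (s, a) u) v = G u (rep q \<mu> X (\<omega> q (y s a)) v)" if "u \<in> \<B> q \<mu> X" for s a u v
  proof -
    note lin = lin_rep[of "\<omega> q (y s a)"]
    show ?thesis
      using bspan_UNIV[of v]
    proof induction
      case (basis v)
      then show ?case unfolding y[symmetric] using G12 G32 that by (simp add: y_def)
    qed (use G(1) in \<open>simp_all add: sesquilinear_def lin_add[OF lin] lin_scale[OF lin]\<close>)
  qed
  \<comment> \<open>The second argument stays arbitrary because each step replaces it by its image
    under the adjoint.\<close>
  have "G u v = F u v" if "u \<in> \<B> q \<mu> X" for u v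
    using that
  proof (induction arbitrary: v rule: basis_vector_induct)
    case one
    have *: "G 1 v = F 1 v" if v: "v \<in> \<B> q \<mu> X" for v
    proof -
      obtain k l where l: "has_level q \<mu> X v k l" using v by (auto simp: \<B>_def)
      then show ?thesis
        by (cases rule: has_level_cases) (use G(2,3) l in \<open>auto simp: F_1 vac_simps vac_qq\<close>)
    qed
    show ?case
      using bspan_UNIV[of v] by (induction rule: bspan.induct)
        (use G(1) * in \<open>simp_all add: sesquilinear_def F_add F_scale\<close>)
  next
    case (qq s a u)
    have "G (qq (s, a) u) v = F (rep q \<mu> X (y s a) u) v"
      by (simp add: step qq contravariant_F del: rep.simps \<omega>.simps)
    then show ?case by (simp only: y)
  qed
  then have "G u v = F u v" for u v
    by (rule sesquilinear_eqI[OF G(1) sesquilinear_F])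
  then show ?thesis by blast
qed

end

theorem theorem2p11:
  fixes q :: complex and \<mu> :: real and X :: "int \<times> int \<Rightarrow> complex^2^2"
  assumes "cmod q = 1"
    and "\<forall>A \<in> K1 \<union> Km1. det (X A) = 1 \<and> X A $ 1 $ 2 = 0"
  shows "(\<exists>!F. level_recursive q (of_real \<mu>) X F) \<and>
    hermitian (the_form q (of_real \<mu>) X) \<and>
    contravariant q (of_real \<mu>) X (the_form q (of_real \<mu>) X)"
proof -
  interpret fock q \<mu> X by standard (fact assms)+
  have ex1: "\<exists>!F. level_recursive q \<mu> X F"
    using level_recursive_F level_recursive_unique by blast
  have the_form: "the_form q \<mu> X = F"
    unfolding the_form_def using level_recursive_F level_recursive_unique by (rule the_equality)
  show ?thesis
    unfolding the_form hermitian_def contravariant_def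
    using ex1 sesquilinear_F F_hermitian contravariant_F by blast
qed

end
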